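(* Let $q\colon\mathbb{C}^+\to\mathbb{C}$ be a Herglotz-Nevanlinna function in one variable, represented by the data $(a,b,\mu)$. Let $n\geq 2$ and let $k_1,\ldots,k_n>0$ be such that $k_1+k_2+\ldots+k_n=1$. Put $b_j:=\frac{k_n}{k_j}$ for $j=1,\ldots,n-1$ and $$\beta_n:=\sum_{j=1}^{n-1}\ \prod_{\substack{i=1\\ i\neq j}}^{n-1}b_i+\prod_{i=1}^{n-1}b_i .$$ Then the function $\tilde q\colon\mathbb{C}^{+n}\to\mathbb{C}$ defined by $$\tilde q(z_1,z_2,\ldots,z_n):=q(k_1z_1+k_2z_2+\ldots+k_nz_n)$$ is a Herglotz-Nevanlinna function represented by the data $(\tilde a,\tilde b,\tilde\mu)$, where $\tilde a=a$, $\tilde b=(k_1b,k_2b,\ldots,k_nb)$ and $\tilde\mu$ is the positive Borel measure on $\mathbb{R}^n$ defined for any Borel set $U\subseteq\mathbb{R}^n$ by $$\tilde\mu(U):=\beta_n\int_{\mathbb{R}}\left(\int_{\mathbb{R}^{n-1}}\chi_U(t_1-b_1t_2,\ldots,t_1-b_{n-1}t_n,\ t_1+t_2+\ldots+t_n)\,\mathrm{d}t_n\ldots\mathrm{d}t_2\right)\mathrm{d}\mu(t_1).$$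
   Context: $\mathbb{C}^+$ is the open upper half-plane and $\mathbb{C}^{+n}:=(\mathbb{C}^+)^n$. A Herglotz-Nevanlinna function in $n$ variables is a holomorphic function on $\mathbb{C}^{+n}$ with non-negative imaginary part. $\chi_U$ denotes the indicator function of $U$. Empty products equal $1$. For $\vec z\in\mathbb{C}^{+n}$ and $\vec t\in\mathbb{R}^n$ the kernel $K_n$ is $$K_n(\vec z,\vec t):=\mathrm{i}\left(\frac{2}{(2\mathrm{i})^n}\prod_{j=1}^n\left(\frac{1}{t_j-z_j}-\frac{1}{t_j+\mathrm{i}}\right)-\frac{1}{(2\mathrm{i})^n}\prod_{j=1}^n\left(\frac{1}{t_j-\mathrm{i}}-\frac{1}{t_j+\mathrm{i}}\right)\right).$$ A function $q$ on $\mathbb{C}^{+n}$ is represented by the data $(a,\vec b,\mu)$ if $a\in\mathbb{R}$, $\vec b=(b_1,\ldots,b_n)$ with all $b_\ell\ge 0$, $\mu$ is a positive Borel measure on $\mathbb{R}^n$ satisfying the growth condition $\int_{\mathbb{R}^n}\prod_{j=1}^n\frac{1}{1+t_j^2}\,\mathrm{d}\mu(\vec t)<\infty$ and the Nevanlinna condition $$\sum_{\substack{\vec\rho\in\{-1,0,1\}^n\\ -1\in\vec\rho\ \wedge\ 1\in\vec\rho}}\int_{\mathbb{R}^n}N_{\rho_1,1}N_{\rho_2,2}\cdots N_{\rho_n,n}\,\mathrm{d}\mu(\vec t)=0\quad\text{for all }\vec z\in\mathbb{C}^{+n},$$ (sum over those $\vec\rho$ having at least one entry $-1$ and at least one entry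 $1$), where $N_{-1,j}:=\frac{1}{t_j-z_j}-\frac{1}{t_j-\mathrm{i}}$, $N_{0,j}:=\frac{1}{t_j-\mathrm{i}}-\frac{1}{t_j+\mathrm{i}}$, $N_{1,j}:=\frac{1}{t_j+\mathrm{i}}-\frac{1}{t_j-\overline{z_j}}$, and $$q(\vec z)=a+\sum_{\ell=1}^n b_\ell z_\ell+\frac{1}{\pi^n}\int_{\mathbb{R}^n}K_n(\vec z,\vec t)\,\mathrm{d}\mu(\vec t)\quad\text{for all }\vec z\in\mathbb{C}^{+n}.$$ For $n=1$ the Nevanlinna condition is vacuous. It is a known theorem that a function on $\mathbb{C}^{+n}$ is Herglotz-Nevanlinna if and only if it is represented by some data in this sense, and that the data are then unique; moreover, if $a\in\mathbb{R}$, $\vec b\in\mathbb{R}^n$ and a positive Borel measure $\mu$ give a Herglotz-Nevanlinna function when inserted into this formula, then they are the data of that function. The measure $\mu$ is called the representing measure of $q$. The numbers $b_j$ (used in the definition of $\tilde\mu$) are unrelated to the number $b$ of the data of $q$; the relation $b_j=k_n/k_j$ is equivalent to $k_\ell=\frac{\prod_{i=1}^{n-1}b_i}{b_\ell\beta_n}$ for $\ell\le n-1$ and $k_n=\frac{\prod_{i=1}^{n-1}b_i}{\beta_n}$. *)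

theory Defs
  imports "HOL-Analysis.Analysis"
begin

text \<open>
  The number of variables is the cardinality of a finite index type: \<open>\<complex>\<^sup>n\<close> is
  \<^typ>\<open>complex^'n\<close> and \<open>\<real>\<^sup>n\<close> is \<^typ>\<open>real^'n\<close> with \<open>n = CARD('n)\<close>.
\<close>

definition upper_poly_halfplane :: "(complex^'n::finite) set" where
  "upper_poly_halfplane = {z. \<forall>j. Im (z $ j) > 0}"

text \<open>
  Holomorphy in several variables: existence at every point of a Frechet derivative that is
  complex linear.  All sets used below are open.
\<close>

definition holomorphic_several :: "(complex^'n::finite \<Rightarrow> complex) \<Rightarrow> (complex^'n) set \<Rightarrow> bool" where
  "holomorphic_several f S \<longleftrightarrow>
     (\<forall>z\<in>S. \<exists>D. (f has_derivative D) (at z) \<and> (\<forall>c v. D (c *s v) = c * D v))"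

definition herglotz_nevanlinna :: "(complex^'n::finite \<Rightarrow> complex) \<Rightarrow> bool" where
  "herglotz_nevanlinna q \<longleftrightarrow>
     holomorphic_several q upper_poly_halfplane \<and> (\<forall>z\<in>upper_poly_halfplane. Im (q z) \<ge> 0)"

definition HN_kernel :: "complex^'n::finite \<Rightarrow> real^'n \<Rightarrow> complex" where
  "HN_kernel z t =
     \<i> * (2 / (2 * \<i>) ^ CARD('n) *
            (\<Prod>j\<in>UNIV. 1 / (of_real (t $ j) - z $ j) - 1 / (of_real (t $ j) + \<i>))
        - 1 / (2 * \<i>) ^ CARD('n) *
            (\<Prod>j\<in>UNIV. 1 / (of_real (t $ j) - \<i>) - 1 / (of_real (t $ j) + \<i>)))"

definition N_factor :: "int \<Rightarrow> complex \<Rightarrow> real \<Rightarrow> complex" where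
  "N_factor r z t =
     (if r = -1 then 1 / (of_real t - z) - 1 / (of_real t - \<i>)
      else if r = 0 then 1 / (of_real t - \<i>) - 1 / (of_real t + \<i>)
      else 1 / (of_real t + \<i>) - 1 / (of_real t - cnj z))"

definition growth_condition :: "(real^'n::finite) measure \<Rightarrow> bool" where
  "growth_condition \<mu> \<longleftrightarrow> (\<integral>\<^sup>+ t. ennreal (\<Prod>j\<in>UNIV. 1 / (1 + (t $ j)\<^sup>2)) \<partial>\<mu>) < \<infinity>"

definition nevanlinna_condition :: "(real^'n::finite) measure \<Rightarrow> bool" where
  "nevanlinna_condition \<mu> \<longleftrightarrow>
     (\<forall>z\<in>upper_poly_halfplane.
        (\<Sum>\<rho> | range \<rho> \<subseteq> {-1, 0, 1} \<and> -1 \<in> range \<rho> \<and> 1 \<in> range \<rho>.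
           (\<integral> t. (\<Prod>j\<in>UNIV. N_factor (\<rho> j) (z $ j) (t $ j)) \<partial>\<mu>)) = 0)"

text \<open>
  The growth condition makes all Bochner integrals occurring here and in the Nevanlinna condition
  converge, because every factor of the integrands is bounded by a multiple of \<open>1 / (1 + t\<^sub>j\<^sup>2)\<close>.
\<close>

definition represented_by ::
    "(complex^'n::finite \<Rightarrow> complex) \<Rightarrow> real \<Rightarrow> real^'n \<Rightarrow> (real^'n) measure \<Rightarrow> bool" where
  "represented_by q a b \<mu> \<longleftrightarrow>
     (\<forall>l. b $ l \<ge> 0) \<and> sets \<mu> = sets borel \<and> growth_condition \<mu> \<and> nevanlinna_condition \<mu> \<and>
     (\<forall>z\<in>upper_poly_halfplane.
        q z = of_real a + (\<Sum>l\<in>UNIV. of_real (b $ l) * z $ l)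
              + 1 / of_real pi ^ CARD('n) * (\<integral> t. HN_kernel z t \<partial>\<mu>))"

text \<open>
  The case \<open>n = 1\<close>, transported from \<open>\<complex>\<^sup>1\<close> and \<open>\<real>\<^sup>1\<close> to \<open>\<complex>\<close> and \<open>\<real>\<close>; the explicit forms are
  \<open>herglotz_nevanlinna1_iff\<close> and \<open>represented_by1_iff\<close> below.
\<close>

definition herglotz_nevanlinna1 :: "(complex \<Rightarrow> complex) \<Rightarrow> bool" where
  "herglotz_nevanlinna1 q \<longleftrightarrow> herglotz_nevanlinna (\<lambda>z::complex^1. q (z $ 1))"

definition represented_by1 ::
    "(complex \<Rightarrow> complex) \<Rightarrow> real \<Rightarrow> real \<Rightarrow> real measure \<Rightarrow> bool" where
  "represented_by1 q a b \<mu> \<longleftrightarrow> sets \<mu> = sets borel \<and>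
     represented_by (\<lambda>z::complex^1. q (z $ 1)) a (vec b) (distr \<mu> borel vec)"

text \<open>
  The distinguished index \<open>m\<close> plays the role of the last index \<open>n\<close>, \<open>t\<close> is \<open>t\<^sub>1\<close>, and each of the
  variables \<open>t\<^sub>2, \<dots>, t\<^sub>n\<close> is indexed by the coordinate in which it occurs with a factor \<open>b\<^sub>j\<close>:
  \<open>s j\<close> is the variable \<open>t\<close> with subscript \<open>j + 1\<close>, for \<open>j \<noteq> m\<close>.  So \<open>tilde_point m b t s\<close> is
  \<open>(t\<^sub>1 - b\<^sub>1 t\<^sub>2, \<dots>, t\<^sub>1 + t\<^sub>2 + \<dots> + t\<^sub>n)\<close>.
\<close>

definition tilde_point :: "'n::finite \<Rightarrow> ('n \<Rightarrow> real) \<Rightarrow> real \<Rightarrow> ('n \<Rightarrow> real) \<Rightarrow> real^'n" where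
  "tilde_point m b t s = (\<chi> j. if j = m then t + (\<Sum>i\<in>UNIV - {m}. s i) else t - b j * s j)"

text \<open>
  \<^const>\<open>measure_of\<close> yields the null measure on set functions that are not measures;
  \<open>emeasure_tilde_measure\<close> below shows that the formula holds on all Borel sets.
\<close>

definition tilde_measure ::
    "'n::finite \<Rightarrow> ('n \<Rightarrow> real) \<Rightarrow> real \<Rightarrow> real measure \<Rightarrow> (real^'n) measure" where
  "tilde_measure m b \<beta> \<mu> =
     measure_of UNIV (sets borel)
       (\<lambda>U. ennreal \<beta> *
          (\<integral>\<^sup>+ t. (\<integral>\<^sup>+ s. indicator U (tilde_point m b t s) \<partial>Pi\<^sub>M (UNIV - {m}) (\<lambda>_. lborel)) \<partial>\<mu>))"

lemma sets_tilde_measure [simp]: "sets (tilde_measure m b \<beta> \<mu>) = sets borel"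
  unfolding tilde_measure_def using sets.sigma_sets_eq[of borel]
  by (simp add: sets_measure_of_conv)

lemma space_tilde_measure [simp]: "space (tilde_measure m b \<beta> \<mu>) = UNIV"
  unfolding tilde_measure_def by (simp add: space_measure_of_conv)

lemma measurable_tilde_point:
  assumes "sets \<mu> = sets borel"
  shows "(\<lambda>(t, s). tilde_point m b t s)
           \<in> borel_measurable (\<mu> \<Otimes>\<^sub>M Pi\<^sub>M (UNIV - {m}) (\<lambda>_. lborel))"
proof -
  have [measurable_cong]: "sets \<mu> = sets borel" by fact
  have "(\<lambda>x. (tilde_point m b (fst x) (snd x)) $ j)
           \<in> borel_measurable (\<mu> \<Otimes>\<^sub>M Pi\<^sub>M (UNIV - {m}) (\<lambda>_. lborel))" for j
  proof (cases "j = m")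
    case True
    then show ?thesis unfolding tilde_point_def by simp measurable
  next
    case False
    then have "(\<lambda>s. s j) \<in> borel_measurable (Pi\<^sub>M (UNIV - {m}) (\<lambda>_. lborel :: real measure))"
      using measurable_component_singleton[of j "UNIV - {m}" "\<lambda>_. lborel :: real measure"] by simp
    then have [measurable]: "(\<lambda>x. snd x j)
           \<in> borel_measurable (\<mu> \<Otimes>\<^sub>M Pi\<^sub>M (UNIV - {m}) (\<lambda>_. lborel :: real measure))"
      by (rule measurable_compose[OF measurable_snd])
    show ?thesis using False unfolding tilde_point_def by simp
  qed
  then show ?thesis
    by (subst borel_measurable_euclidean_space)
      (auto simp: Basis_vec_def inner_axis case_prod_beta)
qed

lemma emeasure_tilde_measure:
  fixes U :: "(real^'n::finite) set"
  assumes "sets \<mu> = sets borel" "U \<in> sets borel"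
  shows "emeasure (tilde_measure m b \<beta> \<mu>) U = ennreal \<beta> *
     (\<integral>\<^sup>+ t. (\<integral>\<^sup>+ s. indicator U (tilde_point m b t s) \<partial>Pi\<^sub>M (UNIV - {m}) (\<lambda>_. lborel)) \<partial>\<mu>)"
proof -
  interpret P: product_sigma_finite "\<lambda>_::'n. lborel :: real measure" ..
  interpret L: finite_product_sigma_finite "\<lambda>_. lborel :: real measure" "UNIV - {m}"
    by unfold_locales auto
  have [measurable_cong]: "sets \<mu> = sets borel" by fact
  note measurable_tilde_point[OF assms(1), of m b, measurable]
  let ?L = "Pi\<^sub>M (UNIV - {m}) (\<lambda>_. lborel :: real measure)"
  have m2: "(\<lambda>(t, s). indicator V (tilde_point m b t s) :: ennreal) \<in> borel_measurable (\<mu> \<Otimes>\<^sub>M ?L)"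
    if "V \<in> sets borel" for V
    using measurable_compose[OF measurable_tilde_point[OF assms(1), of m b]
        borel_measurable_indicator[OF that]] unfolding case_prod_beta .
  have m1: "(\<lambda>s. indicator V (tilde_point m b t s) :: ennreal) \<in> borel_measurable ?L"
    if "V \<in> sets borel" for V t
    using measurable_compose[OF measurable_Pair1'[of t \<mu> ?L] m2[OF that]]
      sets_eq_imp_space_eq[OF assms(1)] by simp
  have m0: "(\<lambda>t. \<integral>\<^sup>+ s. indicator V (tilde_point m b t s) \<partial>?L) \<in> borel_measurable \<mu>"
    if "V \<in> sets borel" for V
    using L.borel_measurable_nn_integral[OF m2[OF that]] by simp
  show ?thesis
  proof (rule emeasure_measure_of[OF tilde_measure_def])
    show "countably_additive (sets (tilde_measure m b \<beta> \<mu>)) (\<lambda>U. ennreal \<beta> *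
       (\<integral>\<^sup>+ t. (\<integral>\<^sup>+ s. indicator U (tilde_point m b t s) \<partial>?L) \<partial>\<mu>))"
    proof (rule countably_additiveI)
      fix A :: "nat \<Rightarrow> (real^'n) set"
      assume "range A \<subseteq> sets (tilde_measure m b \<beta> \<mu>)" and dj: "disjoint_family A"
      then have A: "A i \<in> sets borel" for i by auto
      have ind: "indicator (\<Union>i. A i) x = (\<Sum>i. indicator (A i) x :: ennreal)" for x
        using suminf_indicator[OF dj, of x] by simp
      show "(\<Sum>i. ennreal \<beta> * (\<integral>\<^sup>+ t. (\<integral>\<^sup>+ s. indicator (A i) (tilde_point m b t s) \<partial>?L) \<partial>\<mu>))
         = ennreal \<beta> * (\<integral>\<^sup>+ t. (\<integral>\<^sup>+ s. indicator (\<Union>i. A i) (tilde_point m b t s) \<partial>?L) \<partial>\<mu>)"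
        unfolding ind using A
        by (simp add: nn_integral_suminf m1 m0)
    qed
  qed (use assms in \<open>auto simp: positive_def\<close>)
qed

lemma measurable_vec1 [measurable]: "(vec :: real \<Rightarrow> real^1) \<in> borel_measurable borel"
  unfolding vec_def by (intro borel_measurable_continuous_onI continuous_intros)

lemma upper_poly_halfplane1: "z \<in> upper_poly_halfplane \<longleftrightarrow> Im (z $ (1::1)) > 0"
  by (simp add: upper_poly_halfplane_def forall_1)

lemma holomorphic_several1_iff:
  "holomorphic_several (\<lambda>z::complex^1. q (z $ 1)) upper_poly_halfplane \<longleftrightarrow>
     q holomorphic_on {z. Im z > 0}"
proof
  assume L: "holomorphic_several (\<lambda>z::complex^1. q (z $ 1)) upper_poly_halfplane"
  have "q field_differentiable (at w)" if "Im w > 0" for w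
  proof -
    have "vec w \<in> (upper_poly_halfplane :: (complex^1) set)"
      using that by (simp add: upper_poly_halfplane1)
    with L obtain D where D: "((\<lambda>z::complex^1. q (z $ 1)) has_derivative D) (at (vec w))"
      and lin: "\<And>c v. D (c *s v) = c * D v"
      unfolding holomorphic_several_def by blast
    have "bounded_linear (vec :: complex \<Rightarrow> complex^1)"
      by (intro linear_conv_bounded_linear[THEN iffD1] linearI) (auto simp: vec_eq_iff)
    then have "((vec :: complex \<Rightarrow> complex^1) has_derivative vec) (at w)"
      by (rule bounded_linear_imp_has_derivative)
    from has_derivative_compose[OF this D]
    have "(q has_derivative (\<lambda>x. D (vec x))) (at w)" by simp
    moreover have "D (vec x) = D (vec 1) * x" for x
      using lin[of x "vec 1"] by (simp add: mult.commute vector_scalar_mult_def vec_def)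
    ultimately show ?thesis
      unfolding field_differentiable_def has_field_derivative_def by auto
  qed
  then show "q holomorphic_on {z. Im z > 0}"
    unfolding holomorphic_on_def by (auto intro: field_differentiable_at_within)
next
  assume R: "q holomorphic_on {z. Im z > 0}"
  show "holomorphic_several (\<lambda>z::complex^1. q (z $ 1)) upper_poly_halfplane"
    unfolding holomorphic_several_def
  proof
    fix z :: "complex^1" assume "z \<in> upper_poly_halfplane"
    then obtain d where "(q has_field_derivative d) (at (z $ 1))"
      using holomorphic_on_imp_differentiable_at[OF R open_halfspace_Im_gt]
      by (auto simp: upper_poly_halfplane1 field_differentiable_def)
    then have "((\<lambda>z::complex^1. q (z $ 1)) has_derivative (\<lambda>v. d * v $ 1)) (at z)"
      unfolding has_field_derivative_def
      by (rule has_derivative_compose[rotated])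
        (intro bounded_linear_imp_has_derivative bounded_linear_vec_nth)
    then show "\<exists>D. ((\<lambda>z::complex^1. q (z $ 1)) has_derivative D) (at z) \<and>
        (\<forall>c v. D (c *s v) = c * D v)"
      by (intro exI[of _ "\<lambda>v. d * v $ 1"]) auto
  qed
qed

lemma herglotz_nevanlinna1_iff:
  "herglotz_nevanlinna1 q \<longleftrightarrow>
     q holomorphic_on {z. Im z > 0} \<and> (\<forall>z. Im z > 0 \<longrightarrow> Im (q z) \<ge> 0)"
  unfolding herglotz_nevanlinna1_def herglotz_nevanlinna_def holomorphic_several1_iff
  by (auto simp: upper_poly_halfplane1 Ball_def dest: spec[of _ "vec _"])

lemma nevanlinna_condition1: "nevanlinna_condition (\<mu> :: (real^1) measure)"
proof -
  have "{\<rho> :: 1 \<Rightarrow> int. range \<rho> \<subseteq> {-1, 0, 1} \<and> -1 \<in> range \<rho> \<and> 1 \<in> range \<rho>} = {}"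
    by (auto simp: UNIV_1)
  then show ?thesis unfolding nevanlinna_condition_def by (metis (no_types, lifting) sum.empty)
qed

lemma HN_kernel1:
  assumes "Im (z $ 1) > 0"
  shows "HN_kernel (z :: complex^1) t = 1 / (of_real (t $ 1) - z $ 1) - of_real (t $ 1 / (1 + (t $ 1)\<^sup>2))"
proof -
  define T :: complex where "T = of_real (t $ 1)"
  have nz: "T - z $ 1 \<noteq> 0" "T - \<i> \<noteq> 0" "T + \<i> \<noteq> 0"
    using assms by (auto simp: T_def complex_eq_iff)
  have eq: "1 + T\<^sup>2 = (T - \<i>) * (T + \<i>)" by (simp add: algebra_simps power2_eq_square)
  have "HN_kernel z t = (1 / (T - z $ 1) - 1 / (T + \<i>)) - (1 / (T - \<i>) - 1 / (T + \<i>)) / 2"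
  proof -
    have "\<i> * (2 / (2 * \<i>) * A - 1 / (2 * \<i>) * B) = A - B / 2" for A B :: complex
      by (simp add: field_simps)
    then show ?thesis unfolding HN_kernel_def T_def by (simp only: UNIV_1) simp
  qed
  also have "\<dots> = 1 / (T - z $ 1) - (1 / (T - \<i>) + 1 / (T + \<i>)) / 2"
    by (simp add: field_simps)
  also have "(1 / (T - \<i>) + 1 / (T + \<i>)) / 2 = T / (1 + T\<^sup>2)"
    using nz unfolding eq by (simp add: divide_simps)
  finally show ?thesis by (simp add: T_def)
qed

lemma represented_by1_iff:
  "represented_by1 q a b \<mu> \<longleftrightarrow>
     b \<ge> 0 \<and> sets \<mu> = sets borel \<and> (\<integral>\<^sup>+ t. ennreal (1 / (1 + t\<^sup>2)) \<partial>\<mu>) < \<infinity> \<and>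
     (\<forall>z. Im z > 0 \<longrightarrow>
        q z = of_real a + of_real b * z + 1 / of_real pi *
          (\<integral> t. 1 / (of_real t - z) - of_real (t / (1 + t\<^sup>2)) \<partial>\<mu>))"
proof (cases "sets \<mu> = sets borel")
  case True
  then have v: "(vec :: real \<Rightarrow> real^1) \<in> measurable \<mu> borel"
    using measurable_vec1 measurable_cong_sets by blast
  have g: "growth_condition (distr \<mu> borel vec :: (real^1) measure) \<longleftrightarrow>
      (\<integral>\<^sup>+ t. ennreal (1 / (1 + t\<^sup>2)) \<partial>\<mu>) < \<infinity>"
    unfolding growth_condition_def by (subst nn_integral_distr[OF v]) (simp_all add: UNIV_1)
  have i: "(\<integral> t. HN_kernel z t \<partial>(distr \<mu> borel vec)) =
      (\<integral> t. 1 / (of_real t - z $ 1) - of_real (t / (1 + t\<^sup>2)) \<partial>\<mu>)"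
    if "Im (z $ 1) > 0" for z :: "complex^1"
    unfolding HN_kernel1[OF that] by (subst integral_distr[OF v]) simp_all
  have "(\<forall>z::complex^1. Im (z $ 1) > 0 \<longrightarrow> P (z $ 1)) \<longleftrightarrow> (\<forall>w. Im w > 0 \<longrightarrow> P w)" for P
    by (metis vec_component)
  from this[of "\<lambda>z. q z = of_real a + of_real b * z + 1 / of_real pi *
          (\<integral> t. 1 / (of_real t - z) - of_real (t / (1 + t\<^sup>2)) \<partial>\<mu>)"]
  show ?thesis
    unfolding represented_by1_def represented_by_def
    by (simp add: True g nevanlinna_condition1 upper_poly_halfplane1 Ball_def i UNIV_1
          cong: imp_cong)
qed (simp add: represented_by1_def)

end

theory Submission
  imports Defs "HOL-Real_Asymp.Real_Asymp"
begin

text \<open>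
  The point of \<open>\<real>\<^sup>n\<close> with parameters \<open>t, s\<close> lies on the hyperplane \<open>k\<^sub>1 x\<^sub>1 + \<dots> + k\<^sub>n x\<^sub>n = t\<close>, and
  integrating \<open>\<Prod> f\<^sub>j(x\<^sub>j)\<close> over \<open>s\<close> gives, up to the factor \<open>\<beta>\<close>, the convolution at \<open>t\<close> of the rescaled
  functions \<open>f\<^sub>j(y / k\<^sub>j) / k\<^sub>j\<close>.  All functions in question are built from
  \<open>1 / (y - \<alpha>) - 1 / (y - \<gamma>)\<close> with \<open>\<alpha>\<close> in the upper and \<open>\<gamma>\<close> in the lower half-plane.  By residues,
  poles in the same half-plane add up under convolution and poles in opposite half-planes give \<open>0\<close>, so
  this class is closed under convolution: \<open>\<alpha>, \<gamma>\<close> are replaced by sums and a factor \<open>2 \<pi> \<i>\<close> appears.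
  Hence the fibre integral of \<open>K\<^sub>n\<close> is \<open>\<pi>\<^sup>n\<^sup>-\<^sup>1 K\<^sub>1\<close> at \<open>k\<^sub>1 z\<^sub>1 + \<dots> + k\<^sub>n z\<^sub>n\<close>, and the fibre integral of
  every product in the Nevanlinna condition vanishes, because it involves a function with all poles in the
  upper and one with all poles in the lower half-plane.
\<close>

section \<open>Convolution of simple poles on the real line\<close>

text \<open>The antiderivative \<open>arctan\<close> has finite limits at both ends. Every
  domination argument below rests on this function.\<close>

lemma integrable_inverse_one_plus_square: "integrable lborel (\<lambda>x::real. 1 / (1 + x\<^sup>2))"
proof -
  have "set_integrable lborel (einterval (-\<infinity>) \<infinity>) (\<lambda>x. 1 / (1 + x\<^sup>2))"
  proof (rule interval_integral_FTC_nonneg(1)[where F = arctan and A = "-(pi/2)" and B = "pi/2"])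
    show "((arctan \<circ> real_of_ereal) \<longlongrightarrow> -(pi/2)) (at_right (-\<infinity>))"
      by (simp add: ereal_tendsto_simps1) real_asymp
    show "((arctan \<circ> real_of_ereal) \<longlongrightarrow> pi/2) (at_left \<infinity>)"
      by (simp add: ereal_tendsto_simps1) real_asymp
    show "isCont (\<lambda>x::real. 1 / (1 + x\<^sup>2)) x" for x
      by (intro continuous_intros) (simp add: add_nonneg_eq_0_iff)
    show "(arctan has_real_derivative 1 / (1 + x\<^sup>2)) (at x)" for x
      using DERIV_arctan[of x] by (simp add: field_simps)
  qed auto
  then show ?thesis
    by (simp add: set_integrable_def einterval_def)
qed

section \<open>Size and integral of a product of two simple poles\<close>

lemma of_real_minus_nonreal: "Im \<alpha> \<noteq> 0 \<Longrightarrow> complex_of_real y - \<alpha> \<noteq> 0"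
  by (auto simp: complex_eq_iff)

text \<open>Two estimates are added: the distance of \<open>y\<close> to \<open>\<alpha>\<close> is
  at least \<open>\<bar>Im \<alpha>\<bar>\<close>, which absorbs the constant
  \<open>1 + norm \<alpha>\<close>, and it is at least
  \<open>\<bar>y\<bar> - norm \<alpha>\<close>.\<close>

lemma norm_of_real_minus_ge:
  assumes "Im \<alpha> \<noteq> 0"
  shows "1 + \<bar>y\<bar> \<le> (1 + (1 + norm \<alpha>) / \<bar>Im \<alpha>\<bar>) * norm (complex_of_real y - \<alpha>)"
proof -
  let ?r = "norm (complex_of_real y - \<alpha>)"
  have "\<bar>Im \<alpha>\<bar> \<le> ?r"
    using abs_Im_le_cmod[of "complex_of_real y - \<alpha>"] by simp
  then have "1 \<le> ?r / \<bar>Im \<alpha>\<bar>" using assms by simp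
  then have "1 + norm \<alpha> \<le> (1 + norm \<alpha>) * (?r / \<bar>Im \<alpha>\<bar>)"
    by (metis add_nonneg_nonneg mult_left_mono mult.right_neutral norm_ge_zero zero_le_one)
  moreover have "\<bar>y\<bar> \<le> ?r + norm \<alpha>"
    using norm_triangle_ineq[of "complex_of_real y - \<alpha>" \<alpha>] by simp
  ultimately show ?thesis by (simp add: algebra_simps)
qed

lemma two_poles_bound:
  assumes "Im \<alpha> \<noteq> 0" "Im \<delta> \<noteq> 0"
  obtains C where "C \<ge> 0"
    "\<And>y. norm (1 / ((complex_of_real y - \<alpha>) * (of_real y - \<delta>))) \<le> C * (1 / (1 + y\<^sup>2))"
proof
  define A where "A = 1 + (1 + norm \<alpha>) / \<bar>Im \<alpha>\<bar>"
  define B where "B = 1 + (1 + norm \<delta>) / \<bar>Im \<delta>\<bar>"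
  show "0 \<le> A * B" by (simp add: A_def B_def)
  fix y :: real
  have "(1 + \<bar>y\<bar>) * (1 + \<bar>y\<bar>)
      \<le> (A * norm (complex_of_real y - \<alpha>)) * (B * norm (complex_of_real y - \<delta>))"
    using norm_of_real_minus_ge[OF assms(1), of y] norm_of_real_minus_ge[OF assms(2), of y]
    unfolding A_def B_def by (intro mult_mono) auto
  moreover have "1 + y\<^sup>2 \<le> (1 + \<bar>y\<bar>) * (1 + \<bar>y\<bar>)"
    by (simp add: algebra_simps power2_eq_square)
  ultimately have "1 + y\<^sup>2 \<le> A * B * (norm (complex_of_real y - \<alpha>) * norm (complex_of_real y - \<delta>))"
    by (simp add: mult_ac)
  moreover have "0 < norm (complex_of_real y - \<alpha>) * norm (complex_of_real y - \<delta>)"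
    using of_real_minus_nonreal[OF assms(1), of y] of_real_minus_nonreal[OF assms(2), of y] by simp
  moreover have "0 < 1 + y\<^sup>2" by (simp add: add_pos_nonneg)
  ultimately show "norm (1 / ((complex_of_real y - \<alpha>) * (of_real y - \<delta>))) \<le> A * B * (1 / (1 + y\<^sup>2))"
    by (simp add: norm_divide norm_mult divide_simps mult_ac)
qed

lemma integrable_two_poles:
  assumes "Im \<alpha> \<noteq> 0" "Im \<delta> \<noteq> 0"
  shows "integrable lborel (\<lambda>y. 1 / ((complex_of_real y - \<alpha>) * (of_real y - \<delta>)))"
proof -
  obtain C where C: "\<And>y. norm (1 / ((complex_of_real y - \<alpha>) * (of_real y - \<delta>))) \<le> C * (1 / (1 + y\<^sup>2))"
    using two_poles_bound[OF assms] by metis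
  show ?thesis
  proof (rule Bochner_Integration.integrable_bound)
    show "integrable lborel (\<lambda>y::real. C * (1 / (1 + y\<^sup>2)))"
      using integrable_inverse_one_plus_square by (rule integrable_mult_right)
    show "AE y in lborel. norm (1 / ((complex_of_real y - \<alpha>) * (of_real y - \<delta>)))
        \<le> norm (C * (1 / (1 + y\<^sup>2)))"
      using C by (intro AE_I2) (metis abs_ge_self order_trans real_norm_def)
  qed measurable
qed

text \<open>Up to an additive constant this is a branch of the logarithm of
  \<open>u - \<alpha>\<close> along the real line. With \<open>arctan\<close> in place of the
  argument no cut is crossed, and the limits at both ends are explicit.\<close>

lemma nonreal_pole_antiderivative:
  assumes "Im \<alpha> \<noteq> 0"
  shows "((\<lambda>u. Complex (ln ((u - Re \<alpha>)\<^sup>2 + (Im \<alpha>)\<^sup>2) / 2) (arctan ((u - Re \<alpha>) / Im \<alpha>)))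
      has_vector_derivative 1 / (complex_of_real u - \<alpha>)) (at u)"
proof -
  let ?a = "Re \<alpha>" and ?b = "Im \<alpha>"
  have pos: "(u - ?a)\<^sup>2 + ?b\<^sup>2 > 0" using assms by (simp add: add_nonneg_pos)
  have "((\<lambda>u. ln ((u - ?a)\<^sup>2 + ?b\<^sup>2) / 2) has_field_derivative
      (1 / ((u - ?a)\<^sup>2 + ?b\<^sup>2) * (2 * (u - ?a))) / 2) (at u)"
    using DERIV_ln_divide[OF pos]
    by (intro DERIV_cdivide DERIV_chain2[where f = ln]) (auto intro!: derivative_eq_intros)
  moreover have "(1 / ((u - ?a)\<^sup>2 + ?b\<^sup>2) * (2 * (u - ?a))) / 2 = Re (1 / (complex_of_real u - \<alpha>))"
  proof -
    have "1 / X * (2 * c) / 2 = c / X" for X c :: real by simp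
    then show ?thesis by (simp only:) (simp add: Re_divide)
  qed
  ultimately have "((\<lambda>u. ln ((u - ?a)\<^sup>2 + ?b\<^sup>2) / 2) has_field_derivative
      Re (1 / (complex_of_real u - \<alpha>))) (at u)"
    by simp
  moreover have "((\<lambda>u. arctan ((u - ?a) / ?b)) has_field_derivative Im (1 / (complex_of_real u - \<alpha>))) (at u)"
  proof -
    have eq: "1 + ((u - ?a) / ?b)\<^sup>2 = ((u - ?a)\<^sup>2 + ?b\<^sup>2) / ?b\<^sup>2"
      using assms by (simp add: power_divide add_divide_distrib)
    have "((\<lambda>u. arctan ((u - ?a) / ?b)) has_field_derivative 1 / (1 + ((u - ?a) / ?b)\<^sup>2) * (1 / ?b)) (at u)"
      using assms by (auto intro!: derivative_eq_intros simp: field_simps)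
    moreover have "1 / (1 + ((u - ?a) / ?b)\<^sup>2) * (1 / ?b) = Im (1 / (complex_of_real u - \<alpha>))"
      unfolding eq using pos assms by (simp add: Im_divide power2_eq_square)
    ultimately show ?thesis by simp
  qed
  ultimately show ?thesis
    unfolding has_vector_derivative_complex_iff by simp
qed

text \<open>For \<open>\<alpha> = \<delta>\<close> the value is \<open>0 / 0 = 0\<close>, which is correct.\<close>

lemma has_bochner_integral_two_poles:
  assumes "Im \<alpha> \<noteq> 0" "Im \<delta> \<noteq> 0"
  shows "has_bochner_integral lborel (\<lambda>y. 1 / ((complex_of_real y - \<alpha>) * (of_real y - \<delta>)))
     (of_real (pi * (sgn (Im \<alpha>) - sgn (Im \<delta>))) * \<i> / (\<alpha> - \<delta>))"
proof -
  let ?f = "\<lambda>y. 1 / ((complex_of_real y - \<alpha>) * (of_real y - \<delta>))"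
  \<comment> \<open>Stated for an arbitrary antiderivative, because a double pole and two distinct
    poles require different ones.\<close>
  have FTC: "(\<integral>y. ?f y \<partial>lborel) = B - A"
    if "\<And>y. (F has_vector_derivative ?f y) (at y)" "(F \<longlongrightarrow> A) at_bot" "(F \<longlongrightarrow> B) at_top" for F A B
  proof -
    have "(LBINT y=-\<infinity>..\<infinity>. ?f y) = B - A"
      using that integrable_two_poles[OF assms] assms
      by (intro interval_integral_FTC_integrable[where F = F])
        (auto simp: ereal_tendsto_simps1 set_integrable_def einterval_def of_real_minus_nonreal
          intro!: continuous_intros)
    then show ?thesis
      by (simp add: interval_lebesgue_integral_def einterval_def set_lebesgue_integral_def)
  qed
  have "(\<integral>y. ?f y \<partial>lborel) = of_real (pi * (sgn (Im \<alpha>) - sgn (Im \<delta>))) * \<i> / (\<alpha> - \<delta>)"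
  proof (cases "\<alpha> = \<delta>")
    case True
    have "(\<integral>y. ?f y \<partial>lborel) = 0 - 0"
    proof (rule FTC)
      show "((\<lambda>y. - 1 / (complex_of_real y - \<alpha>)) has_vector_derivative ?f y) (at y)" for y
        using assms True
        by (auto intro!: derivative_eq_intros has_vector_derivative_real_field
            simp: of_real_minus_nonreal)
      \<comment> \<open>\<open>G\<close> stands for either end of the line; the lower bound
        \<open>\<bar>y\<bar> - norm \<alpha>\<close> of the denominator tends to infinity at
        both.\<close>
      have lim: "((\<lambda>y. - 1 / (complex_of_real y - \<alpha>)) \<longlongrightarrow> 0) G"
        if G: "filterlim (\<lambda>y::real. \<bar>y\<bar> - norm \<alpha>) at_top G" for G
      proof (rule tendsto_divide_0[OF tendsto_const])
        have "\<bar>y\<bar> - norm \<alpha> \<le> norm (complex_of_real y - \<alpha>)" for y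
          using norm_triangle_ineq2[of "complex_of_real y" \<alpha>] by simp
        then show "filterlim (\<lambda>y. complex_of_real y - \<alpha>) at_infinity G"
          unfolding filterlim_at_infinity_conv_norm_at_top
          by (intro filterlim_at_top_mono[OF G]) simp
      qed
      show "((\<lambda>y. - 1 / (complex_of_real y - \<alpha>)) \<longlongrightarrow> 0) at_bot" by (rule lim) real_asymp
      show "((\<lambda>y. - 1 / (complex_of_real y - \<alpha>)) \<longlongrightarrow> 0) at_top" by (rule lim) real_asymp
    qed
    then show ?thesis using True by simp
  next
    case False
    define L where "L \<alpha> u = Complex (ln ((u - Re \<alpha>)\<^sup>2 + (Im \<alpha>)\<^sup>2) / 2) (arctan ((u - Re \<alpha>) / Im \<alpha>))" for \<alpha> u
    define F where "F u = (L \<alpha> u - L \<delta> u) / (\<alpha> - \<delta>)" for u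
    \<comment> \<open>\<open>S\<close> is the limit of \<open>F\<close> at \<open>at_top\<close>.
      The \<open>arctan\<close> terms change sign at the other end, so the limit there is
      \<open>- S\<close> and the integral is \<open>2 * S\<close>.\<close>
    define S where "S = \<i> * of_real (pi/2 * (sgn (Im \<alpha>) - sgn (Im \<delta>))) / (\<alpha> - \<delta>)"
    have at: "((\<lambda>u::real. arctan ((u - a) / b)) \<longlongrightarrow> sgn b * (pi/2)) at_top"
      "((\<lambda>u::real. arctan ((u - a) / b)) \<longlongrightarrow> - (sgn b * (pi/2))) at_bot" if "b \<noteq> 0" for a b
      using that by (cases "b > 0"; simp; real_asymp)+
    have "(\<integral>y. ?f y \<partial>lborel) = S - (- S)"
    proof (rule FTC)
      have "(F has_vector_derivative (1 / (complex_of_real y - \<alpha>) - 1 / (complex_of_real y - \<delta>)) / (\<alpha> - \<delta>)) (at y)" for y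
        unfolding F_def L_def
        by (intro has_vector_derivative_divide has_vector_derivative_diff nonreal_pole_antiderivative assms)
      moreover have "(1 / (complex_of_real y - \<alpha>) - 1 / (complex_of_real y - \<delta>)) / (\<alpha> - \<delta>) = ?f y" for y
        using False assms of_real_minus_nonreal[of \<alpha> y] of_real_minus_nonreal[of \<delta> y]
        by (simp add: divide_simps)
      ultimately show "(F has_vector_derivative ?f y) (at y)" for y by metis
      \<comment> \<open>The two logarithms are grouped into one difference: each of them diverges,
        but the difference tends to 0.\<close>
      have Fc: "F u = (of_real (ln ((u - Re \<alpha>)\<^sup>2 + (Im \<alpha>)\<^sup>2) / 2 - ln ((u - Re \<delta>)\<^sup>2 + (Im \<delta>)\<^sup>2) / 2)
         + \<i> * of_real (arctan ((u - Re \<alpha>) / Im \<alpha>) - arctan ((u - Re \<delta>) / Im \<delta>))) / (\<alpha> - \<delta>)" for u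
        by (simp add: F_def L_def Complex_eq algebra_simps)
      have "(F \<longlongrightarrow> (of_real 0 + \<i> * of_real (sgn (Im \<alpha>) * (pi/2) - sgn (Im \<delta>) * (pi/2))) / (\<alpha> - \<delta>)) at_top"
        unfolding Fc using False
        by (intro tendsto_intros at assms) (real_asymp, simp)
      then show "(F \<longlongrightarrow> S) at_top"
        by (simp add: S_def algebra_simps)
      have "(F \<longlongrightarrow> (of_real 0 + \<i> * of_real (- (sgn (Im \<alpha>) * (pi/2)) - - (sgn (Im \<delta>) * (pi/2)))) / (\<alpha> - \<delta>)) at_bot"
        unfolding Fc using False
        by (intro tendsto_intros at assms) (real_asymp, simp)
      moreover have "(of_real 0 + \<i> * of_real (- (sgn (Im \<alpha>) * (pi/2)) - - (sgn (Im \<delta>) * (pi/2)))) / (\<alpha> - \<delta>) = - S"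
        unfolding S_def minus_divide_left
        by (rule arg_cong2[where f = "(/)"]) (simp_all add: algebra_simps)
      ultimately show "(F \<longlongrightarrow> - S) at_bot" by simp
    qed
    also have "\<dots> = of_real (pi * (sgn (Im \<alpha>) - sgn (Im \<delta>))) * \<i> / (\<alpha> - \<delta>)"
      unfolding S_def diff_divide_distrib[symmetric] minus_divide_left
      by (rule arg_cong2[where f = "(/)"]) (simp_all add: algebra_simps)
    finally show ?thesis .
  qed
  then show ?thesis
    using integrable_two_poles[OF assms] by (simp add: has_bochner_integral_iff)
qed

section \<open>Differences of poles and Poisson kernels under convolution\<close>

text \<open>For non-real poles such a difference decays quadratically and is integrable. All factors
  of the kernel and of the Nevanlinna products have this form.\<close>

definition pole_diff :: "complex \<Rightarrow> complex \<Rightarrow> real \<Rightarrow> complex" where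
  "pole_diff \<alpha> \<gamma> y = 1 / (of_real y - \<alpha>) - 1 / (of_real y - \<gamma>)"

lemma borel_measurable_pole_diff [measurable]: "pole_diff \<alpha> \<gamma> \<in> borel_measurable borel"
  unfolding pole_diff_def by measurable

lemma pole_diff_eq:
  assumes "Im \<alpha> \<noteq> 0" "Im \<gamma> \<noteq> 0"
  shows "pole_diff \<alpha> \<gamma> y = (\<alpha> - \<gamma>) * (1 / ((of_real y - \<alpha>) * (of_real y - \<gamma>)))"
  using of_real_minus_nonreal[OF assms(1), of y] of_real_minus_nonreal[OF assms(2), of y]
  by (simp add: pole_diff_def divide_simps)

text \<open>Up to the factor \<open>1 / pi\<close> this is the Poisson kernel of the upper
  half-plane at height \<open>a\<close>. A product of copies of \<open>poisson 1\<close> is the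
  weight in the growth condition.\<close>

definition poisson :: "real \<Rightarrow> real \<Rightarrow> real" where
  "poisson a y = a / (a\<^sup>2 + y\<^sup>2)"

lemma borel_measurable_poisson [measurable]: "poisson a \<in> borel_measurable borel"
  unfolding poisson_def by measurable

lemma poisson_nonneg: "a \<ge> 0 \<Longrightarrow> 0 \<le> poisson a y"
  by (simp add: poisson_def)

text \<open>Partial fractions at the poles \<open>\<i> * a\<close> and \<open>- \<i> * a\<close>.
  Through this identity the convolution of Poisson kernels becomes a case of the convolution of pole
  differences.\<close>

lemma poisson_eq_pole_diff:
  assumes "a > 0"
  shows "of_real (poisson a y) = pole_diff (\<i> * of_real a) (- \<i> * of_real a) y / (2 * \<i>)"
proof -
  have "(complex_of_real y - \<i> * of_real a) * (of_real y - - \<i> * of_real a) = of_real (a\<^sup>2 + y\<^sup>2)"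
    by (simp add: algebra_simps power2_eq_square)
  then have eq: "pole_diff (\<i> * of_real a) (- \<i> * of_real a) y = 2 * \<i> * (of_real a / of_real (a\<^sup>2 + y\<^sup>2))"
    using assms by (subst pole_diff_eq) simp_all
  have "2 * \<i> * X / (2 * \<i>) = X" for X :: complex by simp
  then show ?thesis unfolding eq poisson_def of_real_divide by (rule sym)
qed

lemma pole_diff_bound:
  assumes "Im \<alpha> \<noteq> 0" "Im \<gamma> \<noteq> 0"
  obtains C where "C \<ge> 0" "\<And>y. norm (pole_diff \<alpha> \<gamma> y) \<le> C * poisson 1 y"
proof -
  obtain C where C: "C \<ge> 0"
    "\<And>y. norm (1 / ((complex_of_real y - \<alpha>) * (of_real y - \<gamma>))) \<le> C * (1 / (1 + y\<^sup>2))"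
    using two_poles_bound[OF assms] by metis
  have "norm (pole_diff \<alpha> \<gamma> y) \<le> norm (\<alpha> - \<gamma>) * C * poisson 1 y" for y
    using mult_left_mono[OF C(2)[of y] norm_ge_zero[of "\<alpha> - \<gamma>"]]
    unfolding pole_diff_eq[OF assms] norm_mult poisson_def by (simp add: mult_ac)
  with C(1) show thesis by (intro that[of "norm (\<alpha> - \<gamma>) * C"]) auto
qed

text \<open>As a function of \<open>u\<close>, the second factor is minus a simple pole at
  \<open>q - \<delta>\<close>, which lies in the half-plane opposite to \<open>\<delta>\<close>.
  This reduces the claim to the integral of two poles and turns the difference of the signs into a
  sum.\<close>

lemma has_bochner_integral_pole_convolution:
  assumes "Im \<alpha> \<noteq> 0" "Im \<delta> \<noteq> 0"
  shows "has_bochner_integral lborel (\<lambda>u. 1 / (of_real u - \<alpha>) * (1 / (of_real (q - u) - \<delta>)))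
     (of_real (pi * (sgn (Im \<alpha>) + sgn (Im \<delta>))) * \<i> / (of_real q - (\<alpha> + \<delta>)))"
proof -
  have "has_bochner_integral lborel (\<lambda>u. - (1 / ((complex_of_real u - \<alpha>) * (of_real u - (of_real q - \<delta>)))))
      (- (of_real (pi * (sgn (Im \<alpha>) - sgn (Im (of_real q - \<delta>)))) * \<i> / (\<alpha> - (of_real q - \<delta>))))"
    using assms by (intro has_bochner_integral_minus has_bochner_integral_two_poles) auto
  moreover have "(\<lambda>u. - (1 / ((complex_of_real u - \<alpha>) * (of_real u - (of_real q - \<delta>)))))
      = (\<lambda>u. 1 / (of_real u - \<alpha>) * (1 / (of_real (q - u) - \<delta>)))"
  proof
    fix u
    have neg: "- (1 / (x * z)) = 1 / x * (1 / w)" if "w = - z" for x z w :: complex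
      using that by simp
    show "- (1 / ((complex_of_real u - \<alpha>) * (of_real u - (of_real q - \<delta>))))
        = 1 / (of_real u - \<alpha>) * (1 / (of_real (q - u) - \<delta>))"
      by (rule neg) simp
  qed
  moreover have "- (of_real (pi * (sgn (Im \<alpha>) - sgn (Im (of_real q - \<delta>)))) * \<i> / (\<alpha> - (of_real q - \<delta>)))
      = of_real (pi * (sgn (Im \<alpha>) + sgn (Im \<delta>))) * \<i> / (of_real q - (\<alpha> + \<delta>))"
  proof -
    have neg: "- (x / z) = y / w" if "x = y" "w = - z" for x y z w :: complex
      using that by simp
    show ?thesis by (rule neg) (simp_all add: sgn_minus)
  qed
  ultimately show ?thesis by (simp only:)
qed

text \<open>The cross terms vanish because the poles of the two factors lie in opposite half-planes.\<close>

lemma has_bochner_integral_pole_diff_convolution: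
  assumes "Im \<alpha> > 0" "Im \<gamma> < 0" "Im \<alpha>' > 0" "Im \<gamma>' < 0"
  shows "has_bochner_integral lborel (\<lambda>u. pole_diff \<alpha> \<gamma> u * pole_diff \<alpha>' \<gamma>' (q - u))
     (2 * of_real pi * \<i> * pole_diff (\<alpha> + \<alpha>') (\<gamma> + \<gamma>') q)"
proof -
  define P where "P \<alpha> u = 1 / (complex_of_real u - \<alpha>)" for \<alpha> u
  define V where "V \<alpha> \<delta> = of_real (pi * (sgn (Im \<alpha>) + sgn (Im \<delta>))) * \<i> / (of_real q - (\<alpha> + \<delta>))"
    for \<alpha> \<delta>
  have conv: "has_bochner_integral lborel (\<lambda>u. P \<alpha> u * P \<delta> (q - u)) (V \<alpha> \<delta>)"
    if "Im \<alpha> \<noteq> 0" "Im \<delta> \<noteq> 0" for \<alpha> \<delta>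
    unfolding P_def V_def using that by (rule has_bochner_integral_pole_convolution)
  \<comment> \<open>Each of the four products obtained by expanding decays quadratically by itself,
    so they can be integrated separately.\<close>
  have "has_bochner_integral lborel
      (\<lambda>u. (P \<alpha> u * P \<alpha>' (q - u) - P \<alpha> u * P \<gamma>' (q - u)) - (P \<gamma> u * P \<alpha>' (q - u) - P \<gamma> u * P \<gamma>' (q - u)))
      ((V \<alpha> \<alpha>' - V \<alpha> \<gamma>') - (V \<gamma> \<alpha>' - V \<gamma> \<gamma>'))"
    using assms by (intro has_bochner_integral_diff conv) auto
  moreover have "(P \<alpha> u * P \<alpha>' (q - u) - P \<alpha> u * P \<gamma>' (q - u)) - (P \<gamma> u * P \<alpha>' (q - u) - P \<gamma> u * P \<gamma>' (q - u))
      = pole_diff \<alpha> \<gamma> u * pole_diff \<alpha>' \<gamma>' (q - u)" for u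
    by (simp add: P_def pole_diff_def algebra_simps)
  moreover have "(V \<alpha> \<alpha>' - V \<alpha> \<gamma>') - (V \<gamma> \<alpha>' - V \<gamma> \<gamma>')
      = 2 * of_real pi * \<i> * pole_diff (\<alpha> + \<alpha>') (\<gamma> + \<gamma>') q"
    using assms by (simp add: V_def pole_diff_def right_diff_distrib mult.commute mult.left_commute)
  ultimately show ?thesis by simp
qed

text \<open>The substitution \<open>u = y + \<kappa> * s\<close> gives the convolution at
  \<open>y + p\<close>, with Jacobian \<open>1 / \<kappa>\<close>.\<close>

lemma has_bochner_integral_pole_diff_affine:
  assumes "Im \<alpha> > 0" "Im \<gamma> < 0" "Im \<alpha>' > 0" "Im \<gamma>' < 0" "\<kappa> > 0"
  shows "has_bochner_integral lborel (\<lambda>s. pole_diff \<alpha> \<gamma> (y + \<kappa> * s) * pole_diff \<alpha>' \<gamma>' (p - \<kappa> * s))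
     (2 * of_real pi * \<i> / of_real \<kappa> * pole_diff (\<alpha> + \<alpha>') (\<gamma> + \<gamma>') (y + p))"
proof -
  have "y + p - (y + \<kappa> * s) = p - \<kappa> * s" for s by simp
  then show ?thesis
    using has_bochner_integral_pole_diff_convolution[OF assms(1-4), of "y + p"] assms(5)
    by (subst (asm) lborel_has_bochner_integral_real_affine_iff[of \<kappa> _ _ y])
      (simp_all add: scaleR_conv_of_real divide_inverse mult_ac)
qed

text \<open>This is the semigroup law of the Poisson kernels. It is stated for the non-negative
  integral because it serves to prove integrability in several variables.\<close>

lemma nn_integral_poisson_affine:
  assumes "a > 0" "c > 0" "\<kappa> > 0"
  shows "(\<integral>\<^sup>+ s. ennreal (poisson a (y + \<kappa> * s) * poisson c (p - \<kappa> * s)) \<partial>lborel)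
     = ennreal (pi / \<kappa> * poisson (a + c) (y + p))"
proof -
  let ?f = "\<lambda>s. poisson a (y + \<kappa> * s) * poisson c (p - \<kappa> * s)"
  let ?g = "\<lambda>s. pole_diff (\<i> * of_real a) (- \<i> * of_real a) (y + \<kappa> * s) *
      pole_diff (\<i> * of_real c) (- \<i> * of_real c) (p - \<kappa> * s)"
  \<comment> \<open>Each Poisson kernel contributes \<open>1 / (2 * \<i>)\<close>. One of these
    cancels the constant \<open>2 * pi * \<i>\<close> of the convolution down to \<open>pi\<close>,
    the other makes the result a Poisson kernel again.\<close>
  have "1 / w ^ 2 * (x * z) = x / w * (z / w)" for w x z :: complex
    by (simp add: power2_eq_square)
  then have eq: "complex_of_real (?f s) = 1 / (2 * \<i>) ^ 2 * ?g s" for s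
    using assms(1,2) by (simp only: of_real_mult poisson_eq_pole_diff)
  have "has_bochner_integral lborel ?g
     (2 * of_real pi * \<i> / of_real \<kappa> * pole_diff (\<i> * of_real a + \<i> * of_real c)
       (- \<i> * of_real a + - \<i> * of_real c) (y + p))"
    using assms by (intro has_bochner_integral_pole_diff_affine) auto
  then have "has_bochner_integral lborel (\<lambda>s. 1 / (2 * \<i>) ^ 2 * ?g s)
     (1 / (2 * \<i>) ^ 2 * (2 * of_real pi * \<i> / of_real \<kappa> * pole_diff (\<i> * of_real a + \<i> * of_real c)
       (- \<i> * of_real a + - \<i> * of_real c) (y + p)))"
    by (rule has_bochner_integral_mult_right)
  then have "has_bochner_integral lborel (\<lambda>s. complex_of_real (?f s))
     (1 / (2 * \<i>) ^ 2 * (2 * of_real pi * \<i> / of_real \<kappa> * pole_diff (\<i> * of_real a + \<i> * of_real c)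
       (- \<i> * of_real a + - \<i> * of_real c) (y + p)))"
    by (simp only: eq)
  also have "1 / (2 * \<i>) ^ 2 * (2 * of_real pi * \<i> / of_real \<kappa> * pole_diff (\<i> * of_real a + \<i> * of_real c)
       (- \<i> * of_real a + - \<i> * of_real c) (y + p)) = complex_of_real (pi / \<kappa> * poisson (a + c) (y + p))"
    using assms by (simp add: poisson_eq_pole_diff power2_eq_square distrib_left)
  finally have *: "has_bochner_integral lborel (\<lambda>s. complex_of_real (?f s))
      (complex_of_real (pi / \<kappa> * poisson (a + c) (y + p)))" .
  have "integrable lborel ?f" "(\<integral>s. ?f s \<partial>lborel) = pi / \<kappa> * poisson (a + c) (y + p)"
    using has_bochner_integral_Re[OF *] by (simp_all add: has_bochner_integral_iff)
  then show ?thesis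
    using assms by (subst nn_integral_eq_integral) (auto simp: poisson_nonneg)
qed

section \<open>Iterated convolution over the fibre variables\<close>

lemma borel_measurable_sum_PiM [measurable]:
  assumes "I \<subseteq> J"
  shows "(\<lambda>s. \<Sum>i\<in>I. s i :: real) \<in> borel_measurable (Pi\<^sub>M J (\<lambda>_. lborel))"
proof (rule borel_measurable_sum)
  fix i assume "i \<in> I"
  with assms show "(\<lambda>s. s i) \<in> borel_measurable (Pi\<^sub>M J (\<lambda>_. lborel))"
    using measurable_component_singleton[of i J "\<lambda>_. lborel :: real measure"] by auto
qed

lemma borel_measurable_prod_PiM:
  fixes f :: "'i \<Rightarrow> real \<Rightarrow> 'b::{second_countable_topology, real_normed_field}"
  assumes "I \<subseteq> J" "\<And>i. i \<in> I \<Longrightarrow> f i \<in> borel_measurable borel"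
  shows "(\<lambda>s. \<Prod>i\<in>I. f i (s i)) \<in> borel_measurable (Pi\<^sub>M J (\<lambda>_. lborel))"
proof (rule borel_measurable_prod)
  fix i assume i: "i \<in> I"
  with assms(1) have "(\<lambda>s. s i) \<in> borel_measurable (Pi\<^sub>M J (\<lambda>_. lborel))"
    using measurable_component_singleton[of i J "\<lambda>_. lborel :: real measure"] by auto
  then show "(\<lambda>s. f i (s i)) \<in> borel_measurable (Pi\<^sub>M J (\<lambda>_. lborel))"
    by (rule measurable_compose) (rule assms(2)[OF i])
qed

text \<open>Integrating out \<open>s i\<close> merges the kernel with parameter \<open>c i\<close>
  into the first one, which changes \<open>a\<close> to \<open>a + c i\<close> and \<open>y\<close>
  to \<open>y + p i\<close>. The induction is therefore over arbitrary \<open>a\<close> and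
  \<open>y\<close>.\<close>

lemma nn_integral_poisson_PiM:
  fixes c p :: "'i \<Rightarrow> real"
  assumes "finite I" "\<kappa> > 0" "\<And>j. c j > 0" "a > 0"
  shows "(\<integral>\<^sup>+ s. ennreal (poisson a (y + \<kappa> * (\<Sum>i\<in>I. s i)) * (\<Prod>j\<in>I. poisson (c j) (p j - \<kappa> * s j)))
       \<partial>Pi\<^sub>M I (\<lambda>_. lborel))
     = ennreal ((pi / \<kappa>) ^ card I * poisson (a + sum c I) (y + sum p I))"
  using assms(1,4)
proof (induction I arbitrary: a y rule: finite_induct)
  case empty
  interpret product_sigma_finite "\<lambda>_::'i. lborel :: real measure" ..
  show ?case by (simp add: nn_integral_empty space_PiM_empty)
next
  case (insert i I)
  interpret product_sigma_finite "\<lambda>_::'i. lborel :: real measure" ..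
  let ?f = "\<lambda>J a y s. poisson a (y + \<kappa> * (\<Sum>i\<in>J. s i)) * (\<Prod>j\<in>J. poisson (c j) (p j - \<kappa> * s j))"
  have meas: "?f J a y \<in> borel_measurable (Pi\<^sub>M J (\<lambda>_. lborel))" for J a y
  proof -
    note borel_measurable_prod_PiM[of J J "\<lambda>j x. poisson (c j) (p j - \<kappa> * x)", measurable]
    show ?thesis by measurable
  qed
  \<comment> \<open>Only two factors depend on \<open>x\<close>: the one belonging to
    \<open>i\<close>, and the first one, which sees \<open>x\<close> through the sum.\<close>
  have upd: "?f (insert i I) a y (s(i := x))
      = (\<Prod>j\<in>I. poisson (c j) (p j - \<kappa> * s j)) *
        (poisson a (y + \<kappa> * (\<Sum>i\<in>I. s i) + \<kappa> * x) * poisson (c i) (p i - \<kappa> * x))" for s x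
  proof -
    have "(\<Sum>j\<in>I. (s(i := x)) j) = (\<Sum>j\<in>I. s j)"
      "(\<Prod>j\<in>I. poisson (c j) (p j - \<kappa> * (s(i := x)) j)) = (\<Prod>j\<in>I. poisson (c j) (p j - \<kappa> * s j))"
      using insert.hyps by (auto intro!: sum.cong prod.cong)
    then show ?thesis using insert.hyps by (simp add: algebra_simps)
  qed
  have nonneg: "0 \<le> (\<Prod>j\<in>I. poisson (c j) (p j - \<kappa> * s j))" for s
    using assms(3) by (intro prod_nonneg ballI poisson_nonneg less_imp_le)
  have "(\<integral>\<^sup>+ s. ennreal (?f (insert i I) a y s) \<partial>Pi\<^sub>M (insert i I) (\<lambda>_. lborel))
      = (\<integral>\<^sup>+ s. (\<integral>\<^sup>+ x. ennreal (?f (insert i I) a y (s(i := x))) \<partial>lborel) \<partial>Pi\<^sub>M I (\<lambda>_. lborel))"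
    using insert.hyps meas[where J = "insert i I"] by (intro product_nn_integral_insert) auto
  also have "\<dots> = (\<integral>\<^sup>+ s. ennreal (pi / \<kappa>) * ennreal (?f I (a + c i) (y + p i) s) \<partial>Pi\<^sub>M I (\<lambda>_. lborel))"
  proof (rule nn_integral_cong)
    fix s :: "'i \<Rightarrow> real"
    have "(\<integral>\<^sup>+ x. ennreal (?f (insert i I) a y (s(i := x))) \<partial>lborel)
       = ennreal (\<Prod>j\<in>I. poisson (c j) (p j - \<kappa> * s j)) *
         ennreal (pi / \<kappa> * poisson (a + c i) (y + \<kappa> * (\<Sum>i\<in>I. s i) + p i))"
      unfolding upd ennreal_mult'[OF nonneg]
      using insert.prems assms(2,3) nn_integral_poisson_affine by (subst nn_integral_cmult) auto
    also have "\<dots> = ennreal (pi / \<kappa>) * ennreal (?f I (a + c i) (y + p i) s)"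
      using assms(2) insert.prems assms(3)[of i] nonneg[of s]
      by (simp flip: ennreal_mult' add: mult_ac add_ac)
    finally show "(\<integral>\<^sup>+ x. ennreal (?f (insert i I) a y (s(i := x))) \<partial>lborel)
      = ennreal (pi / \<kappa>) * ennreal (?f I (a + c i) (y + p i) s)" .
  qed
  also have "\<dots> = ennreal (pi / \<kappa>) *
      ennreal ((pi / \<kappa>) ^ card I * poisson (a + c i + sum c I) (y + p i + sum p I))"
    using meas[where J = I] insert.prems assms(3)[of i]
    by (subst nn_integral_cmult) (auto simp: insert.IH)
  also have "\<dots> = ennreal ((pi / \<kappa>) ^ card (insert i I) *
      poisson (a + sum c (insert i I)) (y + sum p (insert i I)))"
    using assms(2) insert.hyps by (simp flip: ennreal_mult' add: mult_ac add_ac)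
  finally show ?case .
qed

text \<open>Each factor is dominated by a multiple of \<open>poisson 1\<close>, and the product of
  these has a finite integral. Only the size of the factors matters, so each pole may lie in either
  half-plane.\<close>

lemma integrable_pole_diff_PiM:
  fixes \<alpha>' \<gamma>' :: "'i \<Rightarrow> complex"
  assumes "finite I" "\<kappa> > 0" "Im \<alpha> \<noteq> 0" "Im \<gamma> \<noteq> 0" "\<And>j. Im (\<alpha>' j) \<noteq> 0" "\<And>j. Im (\<gamma>' j) \<noteq> 0"
  shows "integrable (Pi\<^sub>M I (\<lambda>_. lborel)) (\<lambda>s. pole_diff \<alpha> \<gamma> (y + \<kappa> * (\<Sum>i\<in>I. s i)) *
      (\<Prod>j\<in>I. pole_diff (\<alpha>' j) (\<gamma>' j) (p j - \<kappa> * s j)))"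
proof -
  obtain C where C: "C \<ge> 0" "\<And>y. norm (pole_diff \<alpha> \<gamma> y) \<le> C * poisson 1 y"
    using pole_diff_bound assms(3,4) by metis
  have "\<forall>j. \<exists>C\<ge>0. \<forall>y. norm (pole_diff (\<alpha>' j) (\<gamma>' j) y) \<le> C * poisson 1 y"
    using pole_diff_bound assms(5,6) by metis
  then obtain D where D: "\<And>j. D j \<ge> 0" "\<And>j y. norm (pole_diff (\<alpha>' j) (\<gamma>' j) y) \<le> D j * poisson 1 y"
    by metis
  let ?P = "\<lambda>s. poisson 1 (y + \<kappa> * (\<Sum>i\<in>I. s i)) * (\<Prod>j\<in>I. poisson 1 (p j - \<kappa> * s j))"
  let ?f = "\<lambda>s. pole_diff \<alpha> \<gamma> (y + \<kappa> * (\<Sum>i\<in>I. s i)) *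
      (\<Prod>j\<in>I. pole_diff (\<alpha>' j) (\<gamma>' j) (p j - \<kappa> * s j))"
  have nonneg: "0 \<le> ?P s" for s
    by (intro mult_nonneg_nonneg prod_nonneg ballI poisson_nonneg) auto
  note borel_measurable_prod_PiM[of I I "\<lambda>j x. poisson 1 (p j - \<kappa> * x)", measurable]
  note borel_measurable_prod_PiM[of I I "\<lambda>j x. pole_diff (\<alpha>' j) (\<gamma>' j) (p j - \<kappa> * x)", measurable]
  have P: "integrable (Pi\<^sub>M I (\<lambda>_. lborel)) ?P"
  proof (rule integrableI_nonneg)
    show "(\<integral>\<^sup>+ s. ennreal (?P s) \<partial>Pi\<^sub>M I (\<lambda>_. lborel)) < \<infinity>"
      using nn_integral_poisson_PiM[of I \<kappa> "\<lambda>_. 1" 1 y p] assms(1,2) by simp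
  qed (use nonneg in auto)
  have "integrable (Pi\<^sub>M I (\<lambda>_. lborel)) (\<lambda>s. C * (\<Prod>j\<in>I. D j) * ?P s)"
    using P by (rule integrable_mult_right)
  then show ?thesis
  proof (rule Bochner_Integration.integrable_bound)
    show "AE s in Pi\<^sub>M I (\<lambda>_. lborel). norm (?f s) \<le> norm (C * (\<Prod>j\<in>I. D j) * ?P s)"
    proof (rule AE_I2)
      fix s
      have "norm (?f s) \<le> (C * poisson 1 (y + \<kappa> * (\<Sum>i\<in>I. s i))) * (\<Prod>j\<in>I. D j * poisson 1 (p j - \<kappa> * s j))"
        unfolding norm_mult prod_norm[symmetric] using C D
        by (intro mult_mono prod_mono) (auto intro!: prod_nonneg mult_nonneg_nonneg poisson_nonneg)
      also have "\<dots> = C * (\<Prod>j\<in>I. D j) * ?P s"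
        by (simp add: prod.distrib mult_ac)
      finally show "norm (?f s) \<le> norm (C * (\<Prod>j\<in>I. D j) * ?P s)" by simp
    qed
  qed measurable
qed

text \<open>The induction is the one for Poisson kernels, with Fubini justified by the preceding
  integrability. A sum of poles from one half-plane stays in that half-plane, so the induction
  hypothesis applies to the merged pair.\<close>

lemma integral_pole_diff_PiM:
  fixes \<alpha>' \<gamma>' :: "'i \<Rightarrow> complex"
  assumes "finite I" "\<kappa> > 0" "Im \<alpha> > 0" "Im \<gamma> < 0" "\<And>j. Im (\<alpha>' j) > 0" "\<And>j. Im (\<gamma>' j) < 0"
  shows "(\<integral>s. pole_diff \<alpha> \<gamma> (y + \<kappa> * (\<Sum>i\<in>I. s i)) *
        (\<Prod>j\<in>I. pole_diff (\<alpha>' j) (\<gamma>' j) (p j - \<kappa> * s j)) \<partial>Pi\<^sub>M I (\<lambda>_. lborel))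
     = (2 * of_real pi * \<i> / of_real \<kappa>) ^ card I * pole_diff (\<alpha> + sum \<alpha>' I) (\<gamma> + sum \<gamma>' I) (y + sum p I)"
  using assms(1,3,4)
proof (induction I arbitrary: \<alpha> \<gamma> y rule: finite_induct)
  case empty
  interpret finite_measure "Pi\<^sub>M {} (\<lambda>_::'i. lborel :: real measure)"
    by rule (simp add: space_PiM)
  show ?case by (simp add: space_PiM measure_def)
next
  case (insert i I)
  interpret product_sigma_finite "\<lambda>_::'i. lborel :: real measure" ..
  let ?f = "\<lambda>J \<alpha> \<gamma> y s. pole_diff \<alpha> \<gamma> (y + \<kappa> * (\<Sum>i\<in>J. s i)) *
      (\<Prod>j\<in>J. pole_diff (\<alpha>' j) (\<gamma>' j) (p j - \<kappa> * s j))"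
  let ?c = "2 * of_real pi * \<i> / of_real \<kappa>"
  have upd: "?f (insert i I) \<alpha> \<gamma> y (s(i := x))
      = (\<Prod>j\<in>I. pole_diff (\<alpha>' j) (\<gamma>' j) (p j - \<kappa> * s j)) *
        (pole_diff \<alpha> \<gamma> (y + \<kappa> * (\<Sum>i\<in>I. s i) + \<kappa> * x) * pole_diff (\<alpha>' i) (\<gamma>' i) (p i - \<kappa> * x))" for s x
  proof -
    have "(\<Sum>j\<in>I. (s(i := x)) j) = (\<Sum>j\<in>I. s j)"
      "(\<Prod>j\<in>I. pole_diff (\<alpha>' j) (\<gamma>' j) (p j - \<kappa> * (s(i := x)) j))
        = (\<Prod>j\<in>I. pole_diff (\<alpha>' j) (\<gamma>' j) (p j - \<kappa> * s j))"
      using insert.hyps by (auto intro!: sum.cong prod.cong)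
    then show ?thesis using insert.hyps by (simp add: algebra_simps)
  qed
  have "(\<integral>s. ?f (insert i I) \<alpha> \<gamma> y s \<partial>Pi\<^sub>M (insert i I) (\<lambda>_. lborel))
      = (\<integral>s. (\<integral>x. ?f (insert i I) \<alpha> \<gamma> y (s(i := x)) \<partial>lborel) \<partial>Pi\<^sub>M I (\<lambda>_. lborel))"
    using insert.hyps insert.prems assms(2,5,6)
    by (intro product_integral_insert integrable_pole_diff_PiM) (auto simp: less_imp_neq less_imp_neq[symmetric])
  also have "\<dots> = (\<integral>s. ?c * ?f I (\<alpha> + \<alpha>' i) (\<gamma> + \<gamma>' i) (y + p i) s \<partial>Pi\<^sub>M I (\<lambda>_. lborel))"
  proof (rule Bochner_Integration.integral_cong[OF refl])
    fix s :: "'i \<Rightarrow> real"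
    have "has_bochner_integral lborel (\<lambda>x. ?f (insert i I) \<alpha> \<gamma> y (s(i := x)))
      ((\<Prod>j\<in>I. pole_diff (\<alpha>' j) (\<gamma>' j) (p j - \<kappa> * s j)) *
         (?c * pole_diff (\<alpha> + \<alpha>' i) (\<gamma> + \<gamma>' i) (y + \<kappa> * (\<Sum>i\<in>I. s i) + p i)))"
      unfolding upd using insert.prems assms(2,5,6)
      by (intro has_bochner_integral_mult_right has_bochner_integral_pole_diff_affine)
    then show "(\<integral>x. ?f (insert i I) \<alpha> \<gamma> y (s(i := x)) \<partial>lborel)
        = ?c * ?f I (\<alpha> + \<alpha>' i) (\<gamma> + \<gamma>' i) (y + p i) s"
      by (simp only: has_bochner_integral_integral_eq) (simp add: mult_ac add_ac)
  qed
  also have "\<dots> = ?c * (?c ^ card I *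
      pole_diff (\<alpha> + \<alpha>' i + sum \<alpha>' I) (\<gamma> + \<gamma>' i + sum \<gamma>' I) (y + p i + sum p I))"
    using insert.prems assms(5)[of i] assms(6)[of i] by (simp add: insert.IH)
  also have "\<dots> = ?c ^ card (insert i I) *
      pole_diff (\<alpha> + sum \<alpha>' (insert i I)) (\<gamma> + sum \<gamma>' (insert i I)) (y + sum p (insert i I))"
    using insert.hyps by (simp add: add_ac)
  finally show ?case .
qed

section \<open>Integration over the hyperplanes\<close>

text \<open>For \<open>c = k $ j\<close> this passes from the coordinate \<open>x $ j\<close> to
  \<open>k $ j * x $ j\<close>. The sum of the latter is constant on the hyperplane, as a
  convolution requires.\<close>

lemma pole_diff_rescale:
  assumes "c > 0"
  shows "pole_diff \<alpha> \<gamma> x = of_real c * pole_diff (of_real c * \<alpha>) (of_real c * \<gamma>) (c * x)"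
proof -
  have "1 / (of_real x - w) = of_real c * (1 / (of_real (c * x) - of_real c * w))" for w :: complex
    using assms by (simp flip: right_diff_distrib)
  then show ?thesis
    unfolding pole_diff_def right_diff_distrib by metis
qed

lemma poisson_rescale:
  assumes "c > 0"
  shows "poisson 1 x = c * poisson c (c * x)"
proof -
  have "c\<^sup>2 + (c * x)\<^sup>2 = c\<^sup>2 * (1 + x\<^sup>2)" by (simp add: algebra_simps power_mult_distrib)
  then show ?thesis using assms by (simp add: poisson_def power2_eq_square)
qed

text \<open>The weights are kept apart from the measure, so that the fibre integrals can be computed
  for one fixed \<open>t\<close>.\<close>

locale convex_weights =
  fixes k :: "real^'n::finite" and m :: 'n and bs :: "'n \<Rightarrow> real" and \<beta> :: real
  assumes k_pos: "k $ j > 0"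
    and k_sum: "(\<Sum>j\<in>UNIV. k $ j) = 1"
    and bs: "j \<noteq> m \<Longrightarrow> bs j = k $ m / k $ j"
    and \<beta>: "\<beta> = (\<Sum>j\<in>UNIV - {m}. \<Prod>i\<in>UNIV - {m} - {j}. bs i) + (\<Prod>i\<in>UNIV - {m}. bs i)"
begin

abbreviation fiber_measure :: "('n \<Rightarrow> real) measure" where
  "fiber_measure \<equiv> Pi\<^sub>M (UNIV - {m}) (\<lambda>_. lborel)"

lemma k_sum_remove: "k $ m + (\<Sum>j\<in>UNIV - {m}. k $ j) = 1"
  using k_sum by (simp add: sum.remove[of UNIV m])

text \<open>Dropping the factor \<open>bs j\<close> multiplies the product of all
  \<open>bs i\<close> by \<open>k $ j / k $ m\<close>; since the weights add up to 1,
  \<open>\<beta>\<close> is that product divided by \<open>k $ m\<close>. The resulting power of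
  \<open>k $ m\<close> cancels the Jacobians \<open>1 / \<kappa>\<close> of the iterated convolution
  with \<open>\<kappa> = k $ m\<close>.\<close>

lemma \<beta>_mult_prod: "\<beta> * (\<Prod>j\<in>UNIV. k $ j) = (k $ m) ^ card (UNIV - {m})"
proof -
  let ?I = "UNIV - {m}" and ?B = "\<Prod>i\<in>UNIV - {m}. bs i"
  have kne: "k $ j \<noteq> 0" for j using k_pos[of j] by simp
  have B: "?B = (k $ m) ^ card ?I / (\<Prod>j\<in>?I. k $ j)"
  proof -
    have "?B = (\<Prod>j\<in>?I. k $ m / k $ j)" by (rule prod.cong) (auto simp: bs)
    then show ?thesis by (simp add: prod_dividef)
  qed
  have "(\<Prod>i\<in>?I - {j}. bs i) = ?B * k $ j / k $ m" if "j \<in> ?I" for j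
    using that kne bs[of j] by (subst prod.remove[of ?I j]) auto
  then have "\<beta> = (\<Sum>j\<in>?I. ?B * k $ j / k $ m) + ?B" by (simp add: \<beta>)
  also have "\<dots> = ?B / k $ m * ((\<Sum>j\<in>?I. k $ j) + k $ m)"
    using kne by (simp add: sum_distrib_left sum_divide_distrib distrib_left mult_ac)
  also have "\<dots> = ?B / k $ m" using k_sum_remove by (simp add: add.commute)
  finally show ?thesis
    using kne by (simp add: B prod.remove[of UNIV m])
qed

lemma \<beta>_pos: "\<beta> > 0"
proof -
  have "\<beta> * (\<Prod>j\<in>UNIV. k $ j) > 0" unfolding \<beta>_mult_prod using k_pos by simp
  moreover have "(\<Prod>j\<in>UNIV. k $ j) > 0" using k_pos by (intro prod_pos) auto
  ultimately show ?thesis by (simp add: zero_less_mult_iff)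
qed

text \<open>The choice of \<open>bs\<close> makes every \<open>s j\<close> enter with the same
  coefficient, \<open>- k $ m\<close> in coordinate \<open>j\<close> and \<open>k $ m\<close> in
  coordinate \<open>m\<close>. This is the pattern of the convolution lemmas with
  \<open>\<kappa> = k $ m\<close>.\<close>

lemma k_tilde_point: "j \<noteq> m \<Longrightarrow> k $ j * tilde_point m bs t s $ j = k $ j * t - k $ m * s j"
  "k $ m * tilde_point m bs t s $ m = k $ m * t + k $ m * (\<Sum>i\<in>UNIV - {m}. s i)"
  using k_pos[of j] by (simp_all add: tilde_point_def bs algebra_simps)

lemma prod_tilde_point:
  fixes f :: "'n \<Rightarrow> real \<Rightarrow> 'a::comm_monoid_mult"
  shows "(\<Prod>j\<in>UNIV. f j (k $ j * tilde_point m bs t s $ j)) =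
    f m (k $ m * t + k $ m * (\<Sum>i\<in>UNIV - {m}. s i)) * (\<Prod>j\<in>UNIV - {m}. f j (k $ j * t - k $ m * s j))"
  by (simp add: prod.remove[of UNIV m] k_tilde_point)

lemma fiber_sum: "k $ m * t + (\<Sum>j\<in>UNIV - {m}. k $ j * t) = t"
  using k_sum_remove by (simp flip: sum_distrib_right distrib_right)

text \<open>After rescaling, the parameters of the Poisson kernels are the weights, whose sum is 1,
  and the arguments add up to \<open>t\<close>. Fibre integration thus carries the growth weight in
  several variables to a multiple of the one in a single variable.\<close>

lemma nn_integral_fiber_poisson:
  "ennreal \<beta> * (\<integral>\<^sup>+ s. ennreal (\<Prod>j\<in>UNIV. poisson 1 (tilde_point m bs t s $ j)) \<partial>fiber_measure)
    = ennreal (pi ^ card (UNIV - {m}) * poisson 1 t)"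
proof -
  let ?K = "\<Prod>j\<in>UNIV. k $ j" and ?I = "UNIV - {m}"
  let ?F = "\<lambda>s. poisson (k $ m) (k $ m * t + k $ m * (\<Sum>i\<in>?I. s i)) *
      (\<Prod>j\<in>?I. poisson (k $ j) (k $ j * t - k $ m * s j))"
  have K: "?K > 0" using k_pos by (intro prod_pos) auto
  have F: "(\<Prod>j\<in>UNIV. poisson 1 (tilde_point m bs t s $ j)) = ?K * ?F s" for s
  proof -
    have "(\<Prod>j\<in>UNIV. poisson 1 (tilde_point m bs t s $ j))
        = (\<Prod>j\<in>UNIV. k $ j * poisson (k $ j) (k $ j * tilde_point m bs t s $ j))"
      by (intro prod.cong refl poisson_rescale k_pos)
    then show ?thesis
      by (simp only: prod.distrib prod_tilde_point[where f = "\<lambda>j. poisson (k $ j)"])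
  qed
  have meas: "?F \<in> borel_measurable fiber_measure"
  proof -
    note borel_measurable_prod_PiM[of ?I ?I "\<lambda>j x. poisson (k $ j) (k $ j * t - k $ m * x)", measurable]
    show ?thesis by measurable
  qed
  have "ennreal \<beta> * (\<integral>\<^sup>+ s. ennreal (?K * ?F s) \<partial>fiber_measure)
      = ennreal \<beta> * (ennreal ?K * (\<integral>\<^sup>+ s. ennreal (?F s) \<partial>fiber_measure))"
    using K meas by (simp add: ennreal_mult' nn_integral_cmult)
  also have "(\<integral>\<^sup>+ s. ennreal (?F s) \<partial>fiber_measure) = ennreal ((pi / k $ m) ^ card ?I * poisson 1 t)"
    using nn_integral_poisson_PiM[of ?I "k $ m" "\<lambda>j. k $ j" "k $ m" "k $ m * t" "\<lambda>j. k $ j * t"]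
    by (simp add: k_pos k_sum_remove fiber_sum)
  also have "ennreal \<beta> * (ennreal ?K * \<dots>) = ennreal (\<beta> * ?K * ((pi / k $ m) ^ card ?I * poisson 1 t))"
    using K \<beta>_pos by (simp add: ennreal_mult' mult.assoc less_imp_le)
  also have "\<beta> * ?K * ((pi / k $ m) ^ card ?I * poisson 1 t) = pi ^ card ?I * poisson 1 t"
    unfolding \<beta>_mult_prod using k_pos[of m] by (simp add: power_divide)
  finally show ?thesis unfolding F .
qed

text \<open>Rescaling moves the poles to \<open>k $ j * \<alpha> j\<close> and
  \<open>k $ j * \<gamma> j\<close>, and the convolution adds them up. For
  \<open>\<alpha> j = z $ j\<close> the new upper pole is the point at which \<open>q\<close> is
  evaluated.\<close>

lemma has_bochner_integral_fiber_pole_diff: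
  assumes "\<And>j. Im (\<alpha> j) > 0" "\<And>j. Im (\<gamma> j) < 0"
  shows "has_bochner_integral fiber_measure
     (\<lambda>s. of_real \<beta> * (\<Prod>j\<in>UNIV. pole_diff (\<alpha> j) (\<gamma> j) (tilde_point m bs t s $ j)))
     ((2 * of_real pi * \<i>) ^ card (UNIV - {m}) *
       pole_diff (\<Sum>j\<in>UNIV. of_real (k $ j) * \<alpha> j) (\<Sum>j\<in>UNIV. of_real (k $ j) * \<gamma> j) t)"
proof -
  let ?K = "\<Prod>j\<in>UNIV. k $ j" and ?I = "UNIV - {m}"
  let ?A = "\<lambda>j. of_real (k $ j) * \<alpha> j" and ?G = "\<lambda>j. of_real (k $ j) * \<gamma> j"
  let ?F = "\<lambda>s. pole_diff (?A m) (?G m) (k $ m * t + k $ m * (\<Sum>i\<in>?I. s i)) *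
      (\<Prod>j\<in>?I. pole_diff (?A j) (?G j) (k $ j * t - k $ m * s j))"
  have Im: "Im (?A j) > 0" "Im (?G j) < 0" for j
    using assms[of j] k_pos[of j] by (simp_all add: mult_pos_neg)
  then have Im': "Im (?A j) \<noteq> 0" "Im (?G j) \<noteq> 0" for j
    using less_imp_neq by fastforce+
  have F: "(\<Prod>j\<in>UNIV. pole_diff (\<alpha> j) (\<gamma> j) (tilde_point m bs t s $ j)) = of_real ?K * ?F s" for s
  proof -
    have "(\<Prod>j\<in>UNIV. pole_diff (\<alpha> j) (\<gamma> j) (tilde_point m bs t s $ j))
        = (\<Prod>j\<in>UNIV. of_real (k $ j) * pole_diff (?A j) (?G j) (k $ j * tilde_point m bs t s $ j))"
      by (intro prod.cong refl pole_diff_rescale k_pos)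
    then show ?thesis
      by (simp only: prod.distrib prod_tilde_point[where f = "\<lambda>j. pole_diff (?A j) (?G j)"] of_real_prod)
  qed
  have "has_bochner_integral fiber_measure ?F
     ((2 * of_real pi * \<i> / of_real (k $ m)) ^ card ?I *
       pole_diff (?A m + sum ?A ?I) (?G m + sum ?G ?I) (k $ m * t + (\<Sum>j\<in>?I. k $ j * t)))"
    unfolding has_bochner_integral_iff
    using Im Im' k_pos by (intro conjI integrable_pole_diff_PiM integral_pole_diff_PiM) auto
  then have "has_bochner_integral fiber_measure (\<lambda>s. of_real (\<beta> * ?K) * ?F s)
     (of_real (\<beta> * ?K) * ((2 * of_real pi * \<i> / of_real (k $ m)) ^ card ?I *
       pole_diff (?A m + sum ?A ?I) (?G m + sum ?G ?I) t))"
    unfolding fiber_sum by (rule has_bochner_integral_mult_right)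
  moreover have "of_real (\<beta> * ?K) * ((2 * of_real pi * \<i> / of_real (k $ m)) ^ card ?I * w)
      = (2 * of_real pi * \<i>) ^ card ?I * w" for w
    unfolding \<beta>_mult_prod using k_pos[of m] by (simp add: power_divide)
  moreover have "of_real (\<beta> * ?K) * ?F s
      = of_real \<beta> * (\<Prod>j\<in>UNIV. pole_diff (\<alpha> j) (\<gamma> j) (tilde_point m bs t s $ j))" for s
    unfolding F of_real_mult by (rule mult.assoc)
  ultimately show ?thesis
    by (simp only: sum.remove[OF finite UNIV_I, of ?A m] sum.remove[OF finite UNIV_I, of ?G m])
qed

end

text \<open>The weight is bounded below on \<open>{- n..n}\<close>, so these intervals have finite
  measure. This makes Tonelli and Fubini available for \<open>\<mu>\<close>.\<close>

lemma sigma_finite_weighted: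
  assumes "sets \<mu> = sets borel" "(\<integral>\<^sup>+ t. ennreal (1 / (1 + t\<^sup>2)) \<partial>\<mu>) < \<infinity>"
  shows "sigma_finite_measure (\<mu> :: real measure)"
proof
  have [measurable_cong]: "sets \<mu> = sets borel" by fact
  have "emeasure \<mu> {- real n..real n} < \<infinity>" for n
  proof -
    have "emeasure \<mu> {- real n..real n} = (\<integral>\<^sup>+ t. indicator {- real n..real n} t \<partial>\<mu>)"
      by simp
    also have "\<dots> \<le> (\<integral>\<^sup>+ t. ennreal (1 + (real n)\<^sup>2) * ennreal (1 / (1 + t\<^sup>2)) \<partial>\<mu>)"
    proof (rule nn_integral_mono)
      fix t :: real
      have "1 \<le> (1 + (real n)\<^sup>2) * (1 / (1 + t\<^sup>2))" if "t \<in> {- real n..real n}"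
      proof -
        have "t\<^sup>2 \<le> (real n)\<^sup>2" using that by (intro abs_le_square_iff[THEN iffD1]) auto
        then show ?thesis by (simp add: divide_simps add_pos_nonneg)
      qed
      then have "indicator {- real n..real n} t \<le> ennreal ((1 + (real n)\<^sup>2) * (1 / (1 + t\<^sup>2)))"
        by (cases "t \<in> {- real n..real n}") (auto simp flip: ennreal_1 intro!: ennreal_leI)
      then show "indicator {- real n..real n} t \<le> ennreal (1 + (real n)\<^sup>2) * ennreal (1 / (1 + t\<^sup>2))"
        by (subst (asm) ennreal_mult') auto
    qed
    also have "\<dots> < \<infinity>"
      using assms(2) by (subst nn_integral_cmult) (auto simp: ennreal_mult_less_top)
    finally show ?thesis .
  qed
  moreover have "(\<Union>n. {- real n..real n}) = UNIV"
  proof -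
    have "\<exists>n. x \<in> {- real n..real n}" for x
      using real_arch_simple[of "\<bar>x\<bar>"] by (auto simp: abs_le_iff minus_le_iff)
    then show ?thesis by auto
  qed
  moreover have "space \<mu> = UNIV" using sets_eq_imp_space_eq[OF assms(1)] by simp
  ultimately show "\<exists>A. countable A \<and> A \<subseteq> sets \<mu> \<and> \<Union>A = space \<mu> \<and> (\<forall>a\<in>A. emeasure \<mu> a \<noteq> \<infinity>)"
    by (intro exI[of _ "range (\<lambda>n. {- real n..real n})"]) (auto simp: less_top)
qed

section \<open>The kernel and the Nevanlinna factors\<close>

text \<open>As a constant multiple of an image of a product measure, the lifted measure is
  accessible to the general integration rules for \<open>density\<close> and
  \<open>distr\<close>.\<close>

lemma tilde_measure_eq_density_distr:
  fixes m :: "'n::finite"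
  assumes "sets \<mu> = sets borel"
  shows "tilde_measure m b \<beta> \<mu> =
    density (distr (\<mu> \<Otimes>\<^sub>M Pi\<^sub>M (UNIV - {m}) (\<lambda>_. lborel)) borel (\<lambda>(t, s). tilde_point m b t s)) (\<lambda>_. ennreal \<beta>)"
    (is "_ = density (distr (\<mu> \<Otimes>\<^sub>M ?L) borel ?T) _")
proof (rule measure_eqI)
  interpret P: product_sigma_finite "\<lambda>_::'n. lborel :: real measure" ..
  interpret L: finite_product_sigma_finite "\<lambda>_. lborel :: real measure" "UNIV - {m}"
    by unfold_locales auto
  note T = measurable_tilde_point[OF assms, of m b]
  fix U assume "U \<in> sets (tilde_measure m b \<beta> \<mu>)"
  then have U: "U \<in> sets borel" by simp
  have "emeasure (density (distr (\<mu> \<Otimes>\<^sub>M ?L) borel ?T) (\<lambda>_. ennreal \<beta>)) U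
      = ennreal \<beta> * emeasure (\<mu> \<Otimes>\<^sub>M ?L) (?T -` U \<inter> space (\<mu> \<Otimes>\<^sub>M ?L))"
    using U by (simp add: emeasure_density_const emeasure_distr[OF T])
  also have "emeasure (\<mu> \<Otimes>\<^sub>M ?L) (?T -` U \<inter> space (\<mu> \<Otimes>\<^sub>M ?L))
      = (\<integral>\<^sup>+ t. \<integral>\<^sup>+ s. indicator (?T -` U \<inter> space (\<mu> \<Otimes>\<^sub>M ?L)) (t, s) \<partial>?L \<partial>\<mu>)"
    by (rule L.emeasure_pair_measure[OF measurable_sets[OF T U]])
  also have "\<dots> = (\<integral>\<^sup>+ t. (\<integral>\<^sup>+ s. indicator U (tilde_point m b t s) \<partial>?L) \<partial>\<mu>)"
    by (intro nn_integral_cong) (auto simp: indicator_def space_pair_measure)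
  finally show "emeasure (tilde_measure m b \<beta> \<mu>) U
      = emeasure (density (distr (\<mu> \<Otimes>\<^sub>M ?L) borel ?T) (\<lambda>_. ennreal \<beta>)) U"
    using emeasure_tilde_measure[OF assms U] by simp
qed simp

section \<open>Cancellation in the expanded Nevanlinna products\<close>

text \<open>Toggling the value at \<open>j\<close> permutes the index set, so the sum equals its own
  negative.\<close>

lemma sum_toggle_eq_0:
  fixes F :: "('n::finite \<Rightarrow> bool) \<Rightarrow> complex"
  assumes "\<And>g. F (g(j := \<not> g j)) = - F g"
  shows "sum F UNIV = 0"
proof -
  have "sum F UNIV = (\<Sum>g\<in>UNIV. F (g(j := \<not> g j)))"
    by (rule sum.reindex_bij_witness[of _ "\<lambda>g. g(j := \<not> g j)" "\<lambda>g. g(j := \<not> g j)"]) auto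
  also have "\<dots> = - sum F UNIV" by (simp add: assms sum_negf)
  finally show ?thesis by simp
qed

text \<open>
  Every Nevanlinna factor is a difference of (at most two) functions \<^const>\<open>pole_diff\<close> with one pole in
  each half-plane, which are selected by a Boolean \<open>e\<close>.  Switching \<open>e\<close> changes the sign, but keeps the
  lower pole if \<open>\<rho>\<^sub>j = -1\<close> and the upper pole if \<open>\<rho>\<^sub>j = 1\<close>; this makes the expanded product cancel.
\<close>

definition factor_sign :: "int \<Rightarrow> bool \<Rightarrow> complex" where
  "factor_sign r e = (if e then 1 else if r = 0 then 0 else - 1)"

definition factor_upper :: "int \<Rightarrow> complex \<Rightarrow> bool \<Rightarrow> complex" where
  "factor_upper r z e = (if e \<and> r = - 1 then z else \<i>)"

definition factor_lower :: "int \<Rightarrow> complex \<Rightarrow> bool \<Rightarrow> complex" where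
  "factor_lower r z e = (if e \<and> r = 1 then cnj z else - \<i>)"

text \<open>For \<open>r = - 1\<close> the term \<open>1 / (x + \<i>)\<close> is subtracted and
  added, for \<open>r = 1\<close> the term \<open>1 / (x - \<i>)\<close> is added and subtracted.
  For \<open>r = 0\<close> the poles already lie in opposite half-planes, and the second summand has
  sign 0.\<close>

lemma N_factor_eq_sum:
  assumes "r \<in> {- 1, 0, 1}"
  shows "N_factor r z x = (\<Sum>e\<in>UNIV. factor_sign r e * pole_diff (factor_upper r z e) (factor_lower r z e) x)"
  using assms
  by (auto simp: UNIV_bool N_factor_def factor_sign_def factor_upper_def factor_lower_def pole_diff_def)

text \<open>Switching \<open>g j\<close> reverses the sign of the product, because
  \<open>\<rho> j \<noteq> 0\<close>, and leaves the argument of \<open>H\<close> unchanged, because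
  \<open>h j\<close> is constant.\<close>

lemma sum_factor_sign_toggle:
  fixes \<rho> :: "'n::finite \<Rightarrow> int" and h :: "'n \<Rightarrow> bool \<Rightarrow> complex" and H :: "complex \<Rightarrow> complex"
  assumes "\<rho> j \<noteq> 0" "h j False = h j True"
  shows "(\<Sum>g\<in>UNIV. (\<Prod>i\<in>UNIV. factor_sign (\<rho> i) (g i)) * H (\<Sum>i\<in>UNIV. h i (g i))) = 0"
proof (rule sum_toggle_eq_0[of _ j])
  fix g :: "'n \<Rightarrow> bool"
  let ?g = "g(j := \<not> g j)"
  have "h i (?g i) = h i (g i)" for i
    using assms(2) by (cases "g j") auto
  moreover have "(\<Prod>i\<in>UNIV. factor_sign (\<rho> i) (?g i)) = - (\<Prod>i\<in>UNIV. factor_sign (\<rho> i) (g i))"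
  proof -
    have "(\<Prod>i\<in>UNIV - {j}. factor_sign (\<rho> i) (?g i)) = (\<Prod>i\<in>UNIV - {j}. factor_sign (\<rho> i) (g i))"
      by (intro prod.cong) auto
    moreover have "factor_sign (\<rho> j) (?g j) = - factor_sign (\<rho> j) (g j)"
      using assms(1) by (simp add: factor_sign_def)
    ultimately show ?thesis by (simp add: prod.remove[of UNIV j])
  qed
  ultimately show "(\<Prod>i\<in>UNIV. factor_sign (\<rho> i) (?g i)) * H (\<Sum>i\<in>UNIV. h i (?g i))
      = - ((\<Prod>i\<in>UNIV. factor_sign (\<rho> i) (g i)) * H (\<Sum>i\<in>UNIV. h i (g i)))"
    by simp
qed

text \<open>Distributivity turns the product of two-term sums into a sum over choice functions
  \<open>g\<close>. For \<open>z j\<close> in the upper half-plane, each summand has the pole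
  pattern required for fibre integration.\<close>

lemma prod_N_factor_eq_sum:
  fixes \<rho> :: "'n::finite \<Rightarrow> int"
  assumes "range \<rho> \<subseteq> {- 1, 0, 1}"
  shows "(\<Prod>j\<in>UNIV. N_factor (\<rho> j) (z j) (x j)) =
     (\<Sum>g\<in>UNIV. (\<Prod>j\<in>UNIV. factor_sign (\<rho> j) (g j)) *
        (\<Prod>j\<in>UNIV. pole_diff (factor_upper (\<rho> j) (z j) (g j)) (factor_lower (\<rho> j) (z j) (g j)) (x j)))"
proof -
  have "(\<Prod>j\<in>UNIV. N_factor (\<rho> j) (z j) (x j)) = (\<Prod>j\<in>UNIV. \<Sum>e\<in>UNIV.
      factor_sign (\<rho> j) e * pole_diff (factor_upper (\<rho> j) (z j) e) (factor_lower (\<rho> j) (z j) e) (x j))"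
    using assms by (intro prod.cong refl N_factor_eq_sum) auto
  also have "\<dots> = (\<Sum>g\<in>UNIV. \<Prod>j\<in>UNIV. factor_sign (\<rho> j) (g j) *
      pole_diff (factor_upper (\<rho> j) (z j) (g j)) (factor_lower (\<rho> j) (z j) (g j)) (x j))"
    by (subst prod_sum_PiE) simp_all
  finally show ?thesis by (simp add: prod.distrib)
qed

lemma HN_kernel_eq_pole_diff:
  fixes z :: "complex^'n::finite"
  shows "HN_kernel z x = 2 * \<i> / (2 * \<i>) ^ CARD('n) * (\<Prod>j\<in>UNIV. pole_diff (z $ j) (- \<i>) (x $ j))
     - \<i> / (2 * \<i>) ^ CARD('n) * (\<Prod>j\<in>(UNIV::'n set). pole_diff \<i> (- \<i>) (x $ j))"
  by (simp add: HN_kernel_def pole_diff_def right_diff_distrib)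

text \<open>The subtracted term is the mean of \<open>1 / (t - \<i>)\<close> and
  \<open>1 / (t + \<i>)\<close>. The left-hand side is the form in which fibre integration of the
  kernel delivers its result.\<close>

lemma HN_kernel_one_variable:
  "(2 * pole_diff \<zeta> (- \<i>) t - pole_diff \<i> (- \<i>) t) / 2 = 1 / (of_real t - \<zeta>) - of_real (t / (1 + t\<^sup>2))"
proof -
  have "of_real t - \<i> \<noteq> 0" "of_real t + \<i> \<noteq> 0" "complex_of_real (1 + t\<^sup>2) = (of_real t - \<i>) * (of_real t + \<i>)"
    by (auto simp: complex_eq_iff power2_eq_square)
  then have "of_real (t / (1 + t\<^sup>2)) = (1 / (of_real t - \<i>) + 1 / (of_real t + \<i>)) / 2"
    unfolding of_real_divide by (simp add: divide_simps)
  moreover have "(2 * (A - C) - (B - C)) / 2 = A - (B + C) / 2" for A B C :: complex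
    by (simp add: field_simps)
  ultimately show ?thesis
    by (simp only: pole_diff_def diff_minus_eq_add)
qed

lemma borel_measurable_vec_prod:
  fixes f :: "'n::finite \<Rightarrow> real \<Rightarrow> 'b::{second_countable_topology, real_normed_field}"
  assumes "\<And>j. f j \<in> borel_measurable borel"
  shows "(\<lambda>x::real^'n. \<Prod>j\<in>UNIV. f j (x $ j)) \<in> borel_measurable borel"
proof (rule borel_measurable_prod)
  fix j
  have "(\<lambda>x::real^'n. x $ j) \<in> borel_measurable borel"
    by (intro borel_measurable_continuous_onI continuous_intros)
  then show "(\<lambda>x::real^'n. f j (x $ j)) \<in> borel_measurable borel"
    by (rule measurable_compose) (rule assms)
qed

section \<open>Integrals against the lifted measure\<close>

locale lifted_measure = convex_weights k m bs \<beta>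
  for k :: "real^'n::finite" and m :: 'n and bs :: "'n \<Rightarrow> real" and \<beta> :: real +
  fixes \<mu> :: "real measure"
  assumes sets_\<mu>: "sets \<mu> = sets borel"
    and growth: "(\<integral>\<^sup>+ t. ennreal (1 / (1 + t\<^sup>2)) \<partial>\<mu>) < \<infinity>"
begin

sublocale P: product_sigma_finite "\<lambda>_::'n. lborel :: real measure" ..

sublocale L: finite_product_sigma_finite "\<lambda>_. lborel :: real measure" "UNIV - {m}"
  by unfold_locales auto

sublocale pair_sigma_finite \<mu> fiber_measure
  by (intro pair_sigma_finite.intro sigma_finite_weighted[OF sets_\<mu> growth] L.sigma_finite_measure_axioms)

abbreviation \<mu>' :: "(real^'n) measure" where
  "\<mu>' \<equiv> tilde_measure m bs \<beta> \<mu>"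

lemmas T_measurable = measurable_tilde_point[OF sets_\<mu>, of m bs]

lemma nn_integral_lifted:
  assumes [measurable]: "h \<in> borel_measurable borel"
  shows "(\<integral>\<^sup>+ x. h x \<partial>\<mu>') =
    (\<integral>\<^sup>+ t. ennreal \<beta> * (\<integral>\<^sup>+ s. h (tilde_point m bs t s) \<partial>fiber_measure) \<partial>\<mu>)"
proof -
  note T_measurable [measurable]
  have m: "(\<lambda>(t, s). h (tilde_point m bs t s)) \<in> borel_measurable (\<mu> \<Otimes>\<^sub>M fiber_measure)"
    using measurable_compose[OF T_measurable assms] by (simp add: case_prod_beta)
  have "(\<integral>\<^sup>+ x. h x \<partial>\<mu>') = ennreal \<beta> * (\<integral>\<^sup>+ (t, s). h (tilde_point m bs t s) \<partial>(\<mu> \<Otimes>\<^sub>M fiber_measure))"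
    unfolding tilde_measure_eq_density_distr[OF sets_\<mu>]
    by (simp add: nn_integral_density nn_integral_distr nn_integral_cmult case_prod_beta')
  also have "\<dots> = ennreal \<beta> * (\<integral>\<^sup>+ t. (\<integral>\<^sup>+ s. h (tilde_point m bs t s) \<partial>fiber_measure) \<partial>\<mu>)"
    using L.nn_integral_fst[OF m] by simp
  also have "\<dots> = (\<integral>\<^sup>+ t. ennreal \<beta> * (\<integral>\<^sup>+ s. h (tilde_point m bs t s) \<partial>fiber_measure) \<partial>\<mu>)"
    using L.borel_measurable_nn_integral_fst[OF m] by (simp add: nn_integral_cmult)
  finally show ?thesis .
qed

text \<open>Fubini on the product of \<open>\<mu>\<close> and the fibre measure. The fibre integral
  enters as a known function \<open>w\<close>, so that it can be evaluated for each \<open>t\<close>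
  beforehand.\<close>

lemma integral_lifted:
  fixes h :: "real^'n \<Rightarrow> complex"
  assumes h: "integrable \<mu>' h"
    and fiber: "\<And>t. has_bochner_integral fiber_measure (\<lambda>s. of_real \<beta> * h (tilde_point m bs t s)) (w t)"
  shows "(\<integral>x. h x \<partial>\<mu>') = (\<integral>t. w t \<partial>\<mu>)"
proof -
  note T_measurable [measurable]
  have hm [measurable]: "h \<in> borel_measurable borel"
    using borel_measurable_integrable[OF h] by (simp add: measurable_cong_sets[OF sets_tilde_measure refl])
  let ?h = "\<lambda>x. of_real \<beta> * h (tilde_point m bs (fst x) (snd x))"
  have int: "integrable (\<mu> \<Otimes>\<^sub>M fiber_measure) ?h"
    and eq: "(\<integral>x. h x \<partial>\<mu>') = integral\<^sup>L (\<mu> \<Otimes>\<^sub>M fiber_measure) ?h"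
    using h \<beta>_pos unfolding tilde_measure_eq_density_distr[OF sets_\<mu>]
    by (simp_all add: integrable_density integral_density integrable_distr_eq integral_distr
        case_prod_beta' scaleR_conv_of_real)
  have "integral\<^sup>L (\<mu> \<Otimes>\<^sub>M fiber_measure) ?h = (\<integral>t. (\<integral>s. of_real \<beta> * h (tilde_point m bs t s) \<partial>fiber_measure) \<partial>\<mu>)"
    using integral_fst'[OF int] by (simp only: fst_conv snd_conv)
  then show ?thesis
    by (simp only: eq has_bochner_integral_integral_eq[OF fiber])
qed

text \<open>The fibre integral of the weight is a constant times \<open>1 / (1 + t\<^sup>2)\<close>,
  so the growth condition on \<open>\<mu>\<close> suffices.\<close>

lemma nn_integral_lifted_poisson:
  "(\<integral>\<^sup>+ x. ennreal (\<Prod>j\<in>UNIV. poisson 1 (x $ j)) \<partial>\<mu>') < \<infinity>"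
proof -
  have m: "(\<lambda>x::real^'n. ennreal (\<Prod>j\<in>UNIV. poisson 1 (x $ j))) \<in> borel_measurable borel"
    using borel_measurable_vec_prod[of "\<lambda>_. poisson 1"] by simp
  have [measurable_cong]: "sets \<mu> = sets borel" by (rule sets_\<mu>)
  have "(\<integral>\<^sup>+ x. ennreal (\<Prod>j\<in>UNIV. poisson 1 (x $ j)) \<partial>\<mu>')
      = (\<integral>\<^sup>+ t. ennreal (pi ^ card (UNIV - {m})) * ennreal (1 / (1 + t\<^sup>2)) \<partial>\<mu>)"
    unfolding nn_integral_lifted[OF m] nn_integral_fiber_poisson
    by (simp add: poisson_def flip: ennreal_mult')
  also have "\<dots> < \<infinity>"
    using growth by (subst nn_integral_cmult) (auto simp: ennreal_mult_less_top)
  finally show ?thesis .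
qed

lemma growth_condition_lifted: "growth_condition \<mu>'"
  using nn_integral_lifted_poisson by (simp add: growth_condition_def poisson_def)

lemma integrable_lifted_pole_diff:
  assumes "\<And>j. Im (\<alpha> j) \<noteq> 0" "\<And>j. Im (\<gamma> j) \<noteq> 0"
  shows "integrable \<mu>' (\<lambda>x. \<Prod>j\<in>UNIV. pole_diff (\<alpha> j) (\<gamma> j) (x $ j))"
proof -
  have "\<forall>j. \<exists>C\<ge>0. \<forall>y. norm (pole_diff (\<alpha> j) (\<gamma> j) y) \<le> C * poisson 1 y"
    using pole_diff_bound assms by metis
  then obtain D where D: "\<And>j. D j \<ge> 0" "\<And>j y. norm (pole_diff (\<alpha> j) (\<gamma> j) y) \<le> D j * poisson 1 y"
    by metis
  let ?P = "\<lambda>x::real^'n. \<Prod>j\<in>UNIV. poisson 1 (x $ j)"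
  have nonneg: "0 \<le> ?P x" for x by (intro prod_nonneg ballI poisson_nonneg) auto
  have "integrable \<mu>' ?P"
    using nn_integral_lifted_poisson nonneg borel_measurable_vec_prod[of "\<lambda>_. poisson 1"]
    by (intro integrableI_nonneg) (auto simp: measurable_cong_sets[OF sets_tilde_measure refl])
  then have "integrable \<mu>' (\<lambda>x. (\<Prod>j\<in>UNIV. D j) * ?P x)"
    by (rule integrable_mult_right)
  then show ?thesis
  proof (rule Bochner_Integration.integrable_bound)
    show "(\<lambda>x. \<Prod>j\<in>UNIV. pole_diff (\<alpha> j) (\<gamma> j) (x $ j)) \<in> borel_measurable \<mu>'"
      using borel_measurable_vec_prod[of "\<lambda>j. pole_diff (\<alpha> j) (\<gamma> j)"]
      by (simp add: measurable_cong_sets[OF sets_tilde_measure refl])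
    show "AE x in \<mu>'. norm (\<Prod>j\<in>UNIV. pole_diff (\<alpha> j) (\<gamma> j) (x $ j)) \<le> norm ((\<Prod>j\<in>UNIV. D j) * ?P x)"
    proof (rule AE_I2)
      fix x :: "real^'n"
      have "norm (\<Prod>j\<in>UNIV. pole_diff (\<alpha> j) (\<gamma> j) (x $ j)) \<le> (\<Prod>j\<in>UNIV. D j * poisson 1 (x $ j))"
        unfolding prod_norm[symmetric] using D by (intro prod_mono) auto
      then show "norm (\<Prod>j\<in>UNIV. pole_diff (\<alpha> j) (\<gamma> j) (x $ j)) \<le> norm ((\<Prod>j\<in>UNIV. D j) * ?P x)"
        by (simp add: prod.distrib)
    qed
  qed
qed

text \<open>Every summand vanishes separately, and already its fibre integral is 0 for each
  \<open>t\<close>. Both an index with \<open>\<rho>\<close> equal to \<open>- 1\<close> and one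
  with \<open>\<rho>\<close> equal to \<open>1\<close> enter the cancellation.\<close>

lemma nevanlinna_condition_lifted: "nevanlinna_condition \<mu>'"
  unfolding nevanlinna_condition_def
proof (intro ballI sum.neutral)
  fix z :: "complex^'n" and \<rho> :: "'n \<Rightarrow> int"
  assume z: "z \<in> upper_poly_halfplane"
    and "\<rho> \<in> {\<rho>. range \<rho> \<subseteq> {- 1, 0, 1} \<and> - 1 \<in> range \<rho> \<and> 1 \<in> range \<rho>}"
  then obtain j\<^sub>0 j\<^sub>1 where \<rho>: "range \<rho> \<subseteq> {- 1, 0, 1}" "\<rho> j\<^sub>0 = - 1" "\<rho> j\<^sub>1 = 1"
    by (metis (mono_tags, lifting) imageE mem_Collect_eq)
  let ?s = "\<lambda>g. \<Prod>j\<in>UNIV. factor_sign (\<rho> j) (g j)"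
  let ?u = "\<lambda>j. factor_upper (\<rho> j) (z $ j)" and ?l = "\<lambda>j. factor_lower (\<rho> j) (z $ j)"
  let ?D = "\<lambda>g x. \<Prod>j\<in>UNIV. pole_diff (?u j (g j)) (?l j (g j)) (x $ j)"
  let ?c = "(2 * of_real pi * \<i>) ^ card (UNIV - {m}) :: complex"
  have Im: "Im (?u j e) > 0" "Im (?l j e) < 0" for j e
    using z by (auto simp: upper_poly_halfplane_def factor_upper_def factor_lower_def)
  then have Im': "Im (?u j e) \<noteq> 0" "Im (?l j e) \<noteq> 0" for j e
    using less_imp_neq by fastforce+
  have "(\<integral>x. (\<Sum>g\<in>UNIV. ?s g * ?D g x) \<partial>\<mu>') = (\<integral>t. 0 \<partial>\<mu>)"
  proof (rule integral_lifted)
    show "integrable \<mu>' (\<lambda>x. \<Sum>g\<in>UNIV. ?s g * ?D g x)"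
      using Im' by (intro Bochner_Integration.integrable_sum integrable_mult_right integrable_lifted_pole_diff)
    fix t
    let ?U = "\<lambda>g. \<Sum>j\<in>UNIV. of_real (k $ j) * ?u j (g j)" and ?L = "\<lambda>g. \<Sum>j\<in>UNIV. of_real (k $ j) * ?l j (g j)"
    have "has_bochner_integral fiber_measure
        (\<lambda>s. \<Sum>g\<in>UNIV. ?s g * (of_real \<beta> * ?D g (tilde_point m bs t s)))
        (\<Sum>g\<in>UNIV. ?s g * (?c * pole_diff (?U g) (?L g) t))"
      using Im by (intro has_bochner_integral_sum has_bochner_integral_mult_right
          has_bochner_integral_fiber_pole_diff)
    moreover have "(\<Sum>g\<in>UNIV. ?s g * (?c * pole_diff (?U g) (?L g) t)) = 0"
    proof -
      \<comment> \<open>One fraction contains only the upper poles and the other only the lower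
        ones. At \<open>j\<^sub>1\<close> the upper pole is \<open>\<i>\<close> for either choice,
        at \<open>j\<^sub>0\<close> the lower pole is \<open>- \<i>\<close>, so toggling there
        cancels the respective sum.\<close>
      have "(\<Sum>g\<in>UNIV. ?s g * (?c * pole_diff (?U g) (?L g) t))
          = (\<Sum>g\<in>UNIV. ?s g * (?c * (1 / (of_real t - ?U g)))) - (\<Sum>g\<in>UNIV. ?s g * (?c * (1 / (of_real t - ?L g))))"
        unfolding pole_diff_def right_diff_distrib sum_subtractf ..
      also have "(\<Sum>g\<in>UNIV. ?s g * (?c * (1 / (of_real t - ?U g)))) = 0"
        using \<rho>(3) by (intro sum_factor_sign_toggle[where j = j\<^sub>1 and H = "\<lambda>w. ?c * (1 / (of_real t - w))"])
          (auto simp: factor_upper_def)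
      also have "(\<Sum>g\<in>UNIV. ?s g * (?c * (1 / (of_real t - ?L g)))) = 0"
        using \<rho>(2) by (intro sum_factor_sign_toggle[where j = j\<^sub>0 and H = "\<lambda>w. ?c * (1 / (of_real t - w))"])
          (auto simp: factor_lower_def)
      finally show ?thesis by simp
    qed
    ultimately show "has_bochner_integral fiber_measure
        (\<lambda>s. of_real \<beta> * (\<Sum>g\<in>UNIV. ?s g * ?D g (tilde_point m bs t s))) 0"
      by (simp add: sum_distrib_left mult.left_commute)
  qed
  then show "(\<integral>x. (\<Prod>j\<in>UNIV. N_factor (\<rho> j) (z $ j) (x $ j)) \<partial>\<mu>') = 0"
    by (simp add: prod_N_factor_eq_sum[OF \<rho>(1)])
qed

text \<open>Both products in the kernel have all their first poles in the upper and all their second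
  poles in the lower half-plane, so each becomes a single pole difference after fibre
  integration.\<close>

lemma integral_lifted_HN_kernel:
  assumes z: "z \<in> upper_poly_halfplane"
  shows "1 / of_real pi ^ CARD('n) * (\<integral>x. HN_kernel z x \<partial>\<mu>') = 1 / of_real pi *
    (\<integral>t. 1 / (of_real t - (\<Sum>j\<in>UNIV. of_real (k $ j) * z $ j)) - of_real (t / (1 + t\<^sup>2)) \<partial>\<mu>)"
proof -
  let ?\<zeta> = "\<Sum>j\<in>UNIV. of_real (k $ j) * z $ j"
  let ?n = "card (UNIV - {m})"
  let ?A = "2 * \<i> / (2 * \<i>) ^ CARD('n)" and ?B = "\<i> / (2 * \<i>) ^ CARD('n)"
  let ?c = "(2 * of_real pi * \<i>) ^ ?n :: complex"
  have n: "CARD('n) = Suc ?n" by (simp add: card_Diff_singleton)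
  have Im: "Im (z $ j) > 0" for j using z by (simp add: upper_poly_halfplane_def)
  then have Im': "Im (z $ j) \<noteq> 0" for j using less_imp_neq by fastforce
  \<comment> \<open>Since the weights add up to 1, the poles at \<open>\<i>\<close> and
    \<open>- \<i>\<close> are not moved.\<close>
  have ksum: "(\<Sum>j\<in>UNIV. of_real (k $ j) * w) = w" for w :: complex
    using k_sum by (simp flip: sum_distrib_right of_real_sum)
  have "(\<integral>x. HN_kernel z x \<partial>\<mu>')
      = (\<integral>t. of_real pi ^ ?n * (1 / (of_real t - ?\<zeta>) - of_real (t / (1 + t\<^sup>2))) \<partial>\<mu>)"
    unfolding HN_kernel_eq_pole_diff
  proof (rule integral_lifted)
    show "integrable \<mu>' (\<lambda>x. ?A * (\<Prod>j\<in>UNIV. pole_diff (z $ j) (- \<i>) (x $ j))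
        - ?B * (\<Prod>j\<in>UNIV. pole_diff \<i> (- \<i>) (x $ j)))"
      using Im' by (intro Bochner_Integration.integrable_diff integrable_mult_right integrable_lifted_pole_diff) auto
    fix t
    have "has_bochner_integral fiber_measure
       (\<lambda>s. ?A * (of_real \<beta> * (\<Prod>j\<in>UNIV. pole_diff (z $ j) (- \<i>) (tilde_point m bs t s $ j)))
          - ?B * (of_real \<beta> * (\<Prod>j\<in>UNIV. pole_diff \<i> (- \<i>) (tilde_point m bs t s $ j))))
       (?A * (?c * pole_diff ?\<zeta> (\<Sum>j\<in>UNIV. of_real (k $ j) * (- \<i>)) t)
          - ?B * (?c * pole_diff (\<Sum>j\<in>UNIV. of_real (k $ j) * \<i>) (\<Sum>j\<in>UNIV. of_real (k $ j) * (- \<i>)) t))"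
      using Im by (intro has_bochner_integral_diff has_bochner_integral_mult_right
          has_bochner_integral_fiber_pole_diff) auto
    moreover have "?A * (?c * X) - ?B * (?c * Y) = of_real pi ^ ?n * ((2 * X - Y) / 2)" for X Y
    proof -
      have "2 * B * (c * X) - B * (c * Y) = B * c * (2 * X - Y)" for B c
        by (simp add: algebra_simps)
      then have *: "?A * (?c * X) - ?B * (?c * Y) = ?B * ?c * (2 * X - Y)"
        by (simp only: times_divide_eq_right[symmetric])
      \<comment> \<open>The denominator has one factor \<open>2 * \<i>\<close> more than the
        convolution constant supplies; with the numerator \<open>\<i>\<close> it leaves the
        \<open>1 / 2\<close> of the one-variable kernel.\<close>
      have "\<i> / (2 * \<i>) ^ Suc N * (2 * of_real pi * \<i>) ^ N = of_real pi ^ N / 2" for N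
        by (simp add: power_mult_distrib)
      then have **: "?B * ?c = of_real pi ^ ?n / 2"
        unfolding n .
      show ?thesis unfolding * ** by simp
    qed
    ultimately have "has_bochner_integral fiber_measure
       (\<lambda>s. ?A * (of_real \<beta> * (\<Prod>j\<in>UNIV. pole_diff (z $ j) (- \<i>) (tilde_point m bs t s $ j)))
          - ?B * (of_real \<beta> * (\<Prod>j\<in>UNIV. pole_diff \<i> (- \<i>) (tilde_point m bs t s $ j))))
       (of_real pi ^ ?n * (1 / (of_real t - ?\<zeta>) - of_real (t / (1 + t\<^sup>2))))"
      by (simp only: ksum HN_kernel_one_variable)
    then show "has_bochner_integral fiber_measure
       (\<lambda>s. of_real \<beta> * (?A * (\<Prod>j\<in>UNIV. pole_diff (z $ j) (- \<i>) (tilde_point m bs t s $ j))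
          - ?B * (\<Prod>j\<in>UNIV. pole_diff \<i> (- \<i>) (tilde_point m bs t s $ j))))
       (of_real pi ^ ?n * (1 / (of_real t - ?\<zeta>) - of_real (t / (1 + t\<^sup>2))))"
      by (simp only: right_diff_distrib mult.left_commute)
  qed
  also have "\<dots> = of_real pi ^ ?n * (\<integral>t. 1 / (of_real t - ?\<zeta>) - of_real (t / (1 + t\<^sup>2)) \<partial>\<mu>)"
    by (rule integral_mult_right_zero)
  finally have eq: "(\<integral>x. HN_kernel z x \<partial>\<mu>')
      = of_real pi ^ ?n * (\<integral>t. 1 / (of_real t - ?\<zeta>) - of_real (t / (1 + t\<^sup>2)) \<partial>\<mu>)" .
  have "1 / complex_of_real pi ^ Suc N * (of_real pi ^ N * w) = 1 / of_real pi * w" for N w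
    by simp
  then show ?thesis unfolding eq n .
qed

end

section \<open>Composition with a convex combination of the variables\<close>

text \<open>The inner map is complex linear, so the chain rule gives a complex linear derivative,
  and positive weights keep its values in the upper half-plane.\<close>

lemma herglotz_nevanlinna_compose_weights:
  fixes k :: "real^'n::finite"
  assumes q: "herglotz_nevanlinna1 q" and k: "\<And>j. k $ j > 0"
  shows "herglotz_nevanlinna (\<lambda>z::complex^'n. q (\<Sum>j\<in>UNIV. of_real (k $ j) * z $ j))"
proof -
  let ?\<zeta> = "\<lambda>z::complex^'n. \<Sum>j\<in>UNIV. of_real (k $ j) * z $ j"
  have hol: "q holomorphic_on {z. Im z > 0}" and nonneg: "\<And>z. Im z > 0 \<Longrightarrow> Im (q z) \<ge> 0"
    using q by (auto simp: herglotz_nevanlinna1_iff)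
  have Im: "Im (?\<zeta> z) > 0" if "z \<in> upper_poly_halfplane" for z
    using that k by (auto simp: upper_poly_halfplane_def intro!: sum_pos)
  show ?thesis
    unfolding herglotz_nevanlinna_def holomorphic_several_def
  proof (intro conjI ballI)
    fix z :: "complex^'n" assume z: "z \<in> upper_poly_halfplane"
    show "0 \<le> Im (q (?\<zeta> z))" by (intro nonneg Im z)
    obtain d where d: "(q has_field_derivative d) (at (?\<zeta> z))"
      using holomorphic_on_imp_differentiable_at[OF hol open_halfspace_Im_gt, of "?\<zeta> z"] Im[OF z]
      by (auto simp: field_differentiable_def)
    have "(?\<zeta> has_derivative ?\<zeta>) (at z)"
      by (intro bounded_linear_imp_has_derivative bounded_linear_sum
          bounded_linear_const_mult bounded_linear_vec_nth)
    from has_derivative_compose[OF this d[unfolded has_field_derivative_def]]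
    show "\<exists>D. ((\<lambda>z. q (?\<zeta> z)) has_derivative D) (at z) \<and> (\<forall>c v. D (c *s v) = c * D v)"
      by (intro exI[of _ "\<lambda>v. d * ?\<zeta> v"]) (simp add: sum_distrib_left mult_ac)
  qed
qed

theorem theorem4p1:
  fixes q :: "complex \<Rightarrow> complex" and a b \<beta> :: real and \<mu> :: "real measure"
    and k :: "real^'n::finite" and m :: 'n and bs :: "'n \<Rightarrow> real"
  assumes "herglotz_nevanlinna1 q"
    and "represented_by1 q a b \<mu>"
    and "CARD('n) \<ge> 2"
    and "\<And>j. k $ j > 0"
    and "(\<Sum>j\<in>UNIV. k $ j) = 1"
    and "\<And>j. j \<noteq> m \<Longrightarrow> bs j = k $ m / k $ j"
    and "\<beta> = (\<Sum>j\<in>UNIV - {m}. \<Prod>i\<in>UNIV - {m} - {j}. bs i) + (\<Prod>i\<in>UNIV - {m}. bs i)"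
  shows "herglotz_nevanlinna (\<lambda>z::complex^'n. q (\<Sum>j\<in>UNIV. of_real (k $ j) * z $ j)) \<and>
         represented_by (\<lambda>z::complex^'n. q (\<Sum>j\<in>UNIV. of_real (k $ j) * z $ j))
           a (\<chi> j. k $ j * b) (tilde_measure m bs \<beta> \<mu>)"
proof
  show "herglotz_nevanlinna (\<lambda>z::complex^'n. q (\<Sum>j\<in>UNIV. of_real (k $ j) * z $ j))"
    using assms(1,4) by (rule herglotz_nevanlinna_compose_weights)
  have b: "b \<ge> 0" and sets: "sets \<mu> = sets borel"
    and growth: "(\<integral>\<^sup>+ t. ennreal (1 / (1 + t\<^sup>2)) \<partial>\<mu>) < \<infinity>"
    and q: "\<And>z. Im z > 0 \<Longrightarrow> q z = of_real a + of_real b * z + 1 / of_real pi *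
          (\<integral> t. 1 / (of_real t - z) - of_real (t / (1 + t\<^sup>2)) \<partial>\<mu>)"
    using assms(2) by (auto simp: represented_by1_iff)
  interpret lifted_measure k m bs \<beta> \<mu>
    by unfold_locales (fact assms sets growth)+
  show "represented_by (\<lambda>z::complex^'n. q (\<Sum>j\<in>UNIV. of_real (k $ j) * z $ j))
           a (\<chi> j. k $ j * b) (tilde_measure m bs \<beta> \<mu>)"
    unfolding represented_by_def
  proof (intro conjI ballI allI)
    show "0 \<le> (\<chi> j. k $ j * b) $ l" for l
      using b assms(4)[of l] by simp
    fix z :: "complex^'n" assume z: "z \<in> upper_poly_halfplane"
    then have "Im (\<Sum>j\<in>UNIV. of_real (k $ j) * z $ j) > 0"
      using assms(4) by (auto simp: upper_poly_halfplane_def intro!: sum_pos)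
    then show "q (\<Sum>j\<in>UNIV. of_real (k $ j) * z $ j) = of_real a
        + (\<Sum>l\<in>UNIV. of_real ((\<chi> j. k $ j * b) $ l) * z $ l)
        + 1 / of_real pi ^ CARD('n) * (\<integral>x. HN_kernel z x \<partial>\<mu>')"
      unfolding integral_lifted_HN_kernel[OF z] by (simp add: q sum_distrib_left mult_ac)
  qed (simp_all add: growth_condition_lifted nevanlinna_condition_lifted)
qed

end
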